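(* Let $\sigma>0$, $\lambda\in\mathcal D$, $q=-\lambda'$, and let $\Lambda$ be an antiderivative of $\lambda$. For every $a\ge0$, $x\in\mathbb R$ and $T>0$, $$\mathcal N_a(T,x)=e^{-\Lambda(x)/\sigma^2}\,\mathbb E^{\mathbb Q_0}\Big[\exp\Big\{\frac{\Lambda(X_T)}{\sigma^2}+\int_0^T\Psi_a(X_s)\,\mathrm ds\Big\}\Big],\qquad X_s=x+\sigma W_s\ \text{under }\mathbb Q_0,$$ as an identity in $[0,\infty]$, where $$\Psi_a(y):=\frac{q(y)}2+\Big(a-\frac12\Big)\frac{\lambda(y)^2}{\sigma^2}.$$
   Context: Class $\mathcal D$: all $\lambda\in C^1(\mathbb R)$ that are strictly decreasing with $\lambda(\theta)=0$ for some (unique) $\theta\in\mathbb R$. For $\lambda\in\mathcal D$ the SDE $\mathrm dX_t=\lambda(X_t)\,\mathrm dt+\sigma\,\mathrm dW_t$, $X_0=x$ ($W$ a standard Brownian motion) has a unique non-explosive strong solution, and $$\mathcal N_a(T,x):=\mathbb E_x\Big[\exp\Big\{a\int_0^T\frac{\lambda(X_s)^2}{\sigma^2}\,\mathrm ds\Big\}\Big]\in[1,\infty].$$ $\mathbb Q_0$ is the law on $C([0,T])$ of $x+\sigma W$ with $W$ a standard Brownian motion, and $X$ denotes the coordinate process. *)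

theory Defs
  imports "HOL-Probability.Probability"
begin

definition class_D :: "(real \<Rightarrow> real) set" where
  "class_D = {l. l C1_differentiable_on UNIV \<and> strict_antimono_on UNIV l \<and> (\<exists>\<theta>. l \<theta> = 0)}"

(* Only the times t >= 0 are constrained. *)
definition brownian_motion :: "'a measure \<Rightarrow> (real \<Rightarrow> 'a \<Rightarrow> real) \<Rightarrow> bool" where
  "brownian_motion M W \<longleftrightarrow>
     prob_space M \<and>
     (\<forall>t\<ge>0. W t \<in> borel_measurable M) \<and>
     (AE \<omega> in M. W 0 \<omega> = 0) \<and>
     (\<forall>\<omega>\<in>space M. continuous_on {0..} (\<lambda>t. W t \<omega>)) \<and>
     (\<forall>s t. 0 \<le> s \<and> s < t \<longrightarrow>
        distributed M lborel (\<lambda>\<omega>. W t \<omega> - W s \<omega>) (normal_density 0 (sqrt (t - s)))) \<and>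
     (\<forall>(n::nat) u. 0 \<le> u 0 \<and> (\<forall>i<n. u i \<le> u (Suc i)) \<longrightarrow>
        prob_space.indep_vars M (\<lambda>_. borel) (\<lambda>i \<omega>. W (u (Suc i)) \<omega> - W (u i) \<omega>) {..<n})"

(* The filtration generated by W, augmented by the null sets of M. *)
definition brownian_filtration :: "'a measure \<Rightarrow> (real \<Rightarrow> 'a \<Rightarrow> real) \<Rightarrow> real \<Rightarrow> 'a measure" where
  "brownian_filtration M W t =
     sigma (space M) ({W s -` B \<inter> space M | s B. 0 \<le> s \<and> s \<le> t \<and> B \<in> sets borel} \<union> null_sets M)"

(* X is a (global, i.e. non-explosive) strong solution of dX = l(X) dt + sigma dW, X_0 = x.
   The noise is additive, so the stochastic integral of the constant sigma is sigma * W. *)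
definition strong_solution ::
  "'a measure \<Rightarrow> (real \<Rightarrow> 'a \<Rightarrow> real) \<Rightarrow> (real \<Rightarrow> real) \<Rightarrow> real \<Rightarrow> real \<Rightarrow> (real \<Rightarrow> 'a \<Rightarrow> real) \<Rightarrow> bool" where
  "strong_solution M W l \<sigma> x X \<longleftrightarrow>
     (\<forall>t\<ge>0. X t \<in> borel_measurable (brownian_filtration M W t)) \<and>
     (\<forall>\<omega>\<in>space M. continuous_on {0..} (\<lambda>t. X t \<omega>)) \<and>
     (AE \<omega> in M. X 0 \<omega> = x \<and>
        (\<forall>t\<ge>0. X t \<omega> = x + integral {0..t} (\<lambda>s. l (X s \<omega>)) + \<sigma> * W t \<omega>))"

(* The expectation E_x[exp(a int_0^T l(X_s)^2 / sigma^2 ds)]; x enters through X. *)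
definition N_functional ::
  "'a measure \<Rightarrow> (real \<Rightarrow> 'a \<Rightarrow> real) \<Rightarrow> (real \<Rightarrow> real) \<Rightarrow> real \<Rightarrow> real \<Rightarrow> real \<Rightarrow> ennreal" where
  "N_functional M X l \<sigma> a T =
     (\<integral>\<^sup>+ \<omega>. ennreal (exp (a * integral {0..T} (\<lambda>s. (l (X s \<omega>))\<^sup>2 / \<sigma>\<^sup>2))) \<partial>M)"

(* The measurable space C([0,T]); paths are extensional functions on {0..T}. The sigma-algebra
   generated by the coordinates is the Borel sigma-algebra of the uniform topology. Only the
   space and the sets of this measure are meaningful. *)
definition path_space :: "real \<Rightarrow> (real \<Rightarrow> real) measure" where
  "path_space T = restrict_space (PiM {0..T} (\<lambda>_. borel)) {w. continuous_on {0..T} w}"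

(* The law on C([0,T]) of x + sigma W. *)
definition Q0 :: "'a measure \<Rightarrow> (real \<Rightarrow> 'a \<Rightarrow> real) \<Rightarrow> real \<Rightarrow> real \<Rightarrow> real \<Rightarrow> (real \<Rightarrow> real) measure" where
  "Q0 M W \<sigma> x T = distr M (path_space T) (\<lambda>\<omega>. \<lambda>t\<in>{0..T}. x + \<sigma> * W t \<omega>)"

definition Psi :: "(real \<Rightarrow> real) \<Rightarrow> real \<Rightarrow> real \<Rightarrow> real \<Rightarrow> real" where
  "Psi l \<sigma> a y = (- deriv l y) / 2 + (a - 1/2) * ((l y)\<^sup>2 / \<sigma>\<^sup>2)"

end

theory Submission
  imports Defs
begin

text \<open>
  Both expectations are limits of expectations over a time grid of mesh \<open>h\<close>. The SDE is discretised by
  the implicit scheme \<open>b = a + h \<cdot> avg l a b + \<sigma> \<Delta>W\<close>, where \<open>avg l a b\<close> is the mean of \<open>l\<close> over the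
  segment from \<open>a\<close> to \<open>b\<close>. As \<open>avg l a b \<cdot> (b - a) = L b - L a\<close>, the sum replacing the stochastic integral
  telescopes, and the density of one step with respect to the driftless step \<open>b = a + \<sigma> \<Delta>W\<close> is
  \<open>exp ((L b - L a) / \<sigma>\<^sup>2 - h (avg l a b)\<^sup>2 / (2 \<sigma>\<^sup>2)) \<cdot> (1 - h \<cdot> \<partial>\<^sub>b avg l a b)\<close>. The Jacobian factors
  multiply up to \<open>exp (\<integral> q/2)\<close> in the limit, since \<open>\<partial>\<^sub>b avg l a b\<close> tends to \<open>l'/2\<close> on the diagonal.
  Hence all limits are pathwise limits of Riemann sums, and no stochastic integral is needed. A cutoff in
  the supremum of the path bounds all quantities, so dominated convergence applies, and it is removed
  by monotone convergence.
\<close>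

section \<open>Averages along segments\<close>

text \<open>The obstacle is growth: \<open>l\<close> need be neither bounded nor globally Lipschitz.
  An explicit Euler scheme may then diverge, and the classical Girsanov route would have to show
  that a stochastic exponential is a true martingale. The sign of \<open>l'\<close> removes both
  difficulties. It makes the implicit step a bijection in the noise for every mesh, and it keeps
  errors from being amplified once the mesh is small against a local Lipschitz constant of
  \<open>l\<close>. The discrete density is the exact ratio of two laws, so nothing has to be proved
  about its total mass. The averaged drift leaves no second-order remainder in the chain rule for
  \<open>L\<close>; the Ito correction is carried by the Jacobian alone. The solution and the
  driftless process may live on unrelated probability spaces. They are compared through the common
  Gaussian law of the increments of their Brownian motions, not through a density between the
  spaces. The cutoff is a function of the grid values, hence part of the functional to which the
  exact discrete identity applies. The mesh tends to zero at a fixed cutoff, since every bound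
  depends on the cutoff level.\<close>

definition avg :: "(real \<Rightarrow> real) \<Rightarrow> real \<Rightarrow> real \<Rightarrow> real" where
  "avg f a b = integral {0..1} (\<lambda>u. f (a + u * (b - a)))"

text \<open>The weight \<open>u\<close> is the derivative of \<open>a + u * (b - a)\<close> in
  \<open>b\<close>, which makes \<open>wavg f' a\<close> the derivative of \<open>avg f a\<close>.
  On the diagonal the weight integrates to 1/2: this is the origin of the halved \<open>q\<close> in
  \<open>Psi\<close>.\<close>

definition wavg :: "(real \<Rightarrow> real) \<Rightarrow> real \<Rightarrow> real \<Rightarrow> real" where
  "wavg f a b = integral {0..1} (\<lambda>u. u * f (a + u * (b - a)))"

lemma avg_integrand_integrable:
  fixes f :: "real \<Rightarrow> real"
  assumes "continuous_on UNIV f"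
  shows "(\<lambda>u. f (a + u * (b - a))) integrable_on {0..1::real}"
proof (rule integrable_continuous_interval)
  show "continuous_on {0..1} (\<lambda>u. f (a + u * (b - a)))"
    by (rule continuous_on_compose2[OF assms]) (auto intro!: continuous_intros)
qed

lemma wavg_integrand_integrable:
  assumes "continuous_on UNIV f"
  shows "(\<lambda>u. u * f (a + u * (b - a))) integrable_on {0..1::real}"
  by (intro integrable_continuous_interval continuous_on_compose2[OF assms] continuous_intros) auto

lemma continuous_on_avg:
  assumes "continuous_on UNIV f"
  shows "continuous_on UNIV (\<lambda>p. avg f (fst p) (snd p))"
proof -
  have "continuous_on (UNIV \<times> cbox 0 1) (\<lambda>(p, u). f (fst p + u * (snd p - fst p)) :: real)"
    unfolding case_prod_beta
    by (intro continuous_on_compose2[OF assms] continuous_intros) auto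
  from integral_continuous_on_param[OF this] show ?thesis
    by (simp add: avg_def)
qed

lemma continuous_on_wavg:
  assumes "continuous_on UNIV f"
  shows "continuous_on UNIV (\<lambda>p. wavg f (fst p) (snd p))"
proof -
  have "continuous_on (UNIV \<times> cbox 0 1) (\<lambda>(p, u). u * f (fst p + u * (snd p - fst p)) :: real)"
    unfolding case_prod_beta
    by (intro continuous_on_compose2[OF assms] continuous_intros) auto
  from integral_continuous_on_param[OF this] show ?thesis
    by (simp add: wavg_def)
qed

lemma avg_same [simp]: "avg f a a = f a"
  by (simp add: avg_def)

lemma wavg_same [simp]: "wavg f a a = f a / 2"
proof -
  have "((\<lambda>u::real. u * f a) has_integral (1\<^sup>2 / 2 * f a - 0\<^sup>2 / 2 * f a)) {0..1}"
    by (rule fundamental_theorem_of_calculus)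
       (auto intro!: derivative_eq_intros simp flip: has_real_derivative_iff_has_vector_derivative)
  then show ?thesis
    by (simp add: wavg_def integral_unique)
qed

text \<open>A chain rule that is exact for finite increments, by the fundamental theorem of calculus
  along the segment.\<close>

lemma avg_mult_diff:
  assumes "\<And>y. (L has_real_derivative f y) (at y)"
  shows "avg f a b * (b - a) = L b - L a"
proof -
  have "((\<lambda>u. f (a + u * (b - a)) * (b - a)) has_integral
          (L (a + 1 * (b - a)) - L (a + 0 * (b - a)))) {0..1}"
  proof (rule fundamental_theorem_of_calculus)
    fix u :: real
    have "((\<lambda>u. a + u * (b - a)) has_real_derivative (b - a)) (at u within {0..1})"
      by (auto intro!: derivative_eq_intros)
    from DERIV_chain'[OF this assms]
    show "((\<lambda>u. L (a + u * (b - a))) has_vector_derivative f (a + u * (b - a)) * (b - a))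
        (at u within {0..1})"
      by (simp add: has_real_derivative_iff_has_vector_derivative mult.commute)
  qed simp
  then show ?thesis
    by (simp add: avg_def integral_unique flip: integral_mult_left)
qed

lemma has_real_derivative_avg:
  assumes der: "\<And>y. (f has_real_derivative f' y) (at y)" and cont: "continuous_on UNIV f'"
  shows "((\<lambda>b. avg f a b) has_real_derivative wavg f' a b) (at b)"
proof -
  have contf: "continuous_on UNIV f"
    by (intro continuous_at_imp_continuous_on ballI DERIV_isCont[OF der])
  have "((\<lambda>b. integral (cbox 0 1) (\<lambda>u. f (a + u * (b - a)))) has_field_derivative
          integral (cbox 0 1) (\<lambda>u. u * f' (a + u * (b - a)))) (at b within UNIV)"
  proof (rule leibniz_rule_field_derivative)
    show "((\<lambda>b. f (a + u * (b - a))) has_field_derivative u * f' (a + u * (b - a))) (at b within UNIV)"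
      for u b
    proof -
      have "((\<lambda>b. a + u * (b - a)) has_real_derivative u) (at b)"
        by (auto intro!: derivative_eq_intros)
      from DERIV_chain'[OF this der] show ?thesis by (simp add: mult.commute)
    qed
    show "(\<lambda>u. f (a + u * (b - a))) integrable_on cbox 0 1" for b
      using avg_integrand_integrable[OF contf] by simp
    show "continuous_on (UNIV \<times> cbox 0 1) (\<lambda>(b, u). u * f' (a + u * (b - a)))"
      unfolding case_prod_beta
      by (intro continuous_on_compose2[OF cont] continuous_intros) auto
  qed auto
  then show ?thesis
    by (simp add: avg_def[abs_def] wavg_def)
qed

lemma avg_antimono:
  assumes "antimono f" "continuous_on UNIV f" "a \<le> a'" "b \<le> b'"
  shows "avg f a' b' \<le> avg f a b"
proof -
  have "f (a' + u * (b' - a')) \<le> f (a + u * (b - a))" if "0 \<le> u" "u \<le> 1" for u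
  proof (rule antimonoD[OF assms(1)])
    have "(1 - u) * a + u * b \<le> (1 - u) * a' + u * b'"
      using that assms by (intro add_mono mult_left_mono) auto
    then show "a + u * (b - a) \<le> a' + u * (b' - a')" by (simp add: algebra_simps)
  qed
  then show ?thesis
    unfolding avg_def by (intro integral_le avg_integrand_integrable assms) auto
qed

text \<open>Moving the left end displaces the point with parameter \<open>u\<close> by
  \<open>(1 - u) * (a - a')\<close>, so the constant of \<open>f\<close> is inherited. A constant on
  a ball is enough, since the ball contains the whole segment by convexity.\<close>

lemma avg_lipschitz_left:
  assumes cont: "continuous_on UNIV f" and K: "K \<ge> 0"
    and lip: "\<And>y z. \<bar>y\<bar> \<le> R \<Longrightarrow> \<bar>z\<bar> \<le> R \<Longrightarrow> \<bar>f y - f z\<bar> \<le> K * \<bar>y - z\<bar>"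
    and "\<bar>a\<bar> \<le> R" "\<bar>a'\<bar> \<le> R" "\<bar>b\<bar> \<le> R"
  shows "\<bar>avg f a b - avg f a' b\<bar> \<le> K * \<bar>a - a'\<bar>"
proof -
  have seg: "\<bar>c + u * (b - c)\<bar> \<le> R" if "0 \<le> u" "u \<le> 1" "\<bar>c\<bar> \<le> R" for c u
  proof -
    have "c + u * (b - c) = (1 - u) * c + u * b" by (simp add: algebra_simps)
    also have "\<bar>\<dots>\<bar> \<le> (1 - u) * \<bar>c\<bar> + u * \<bar>b\<bar>"
      using that abs_triangle_ineq[of "(1 - u) * c" "u * b"] by (simp add: abs_mult)
    also have "\<dots> \<le> (1 - u) * R + u * R"
      using that assms by (intro add_mono mult_left_mono) auto
    finally show ?thesis by (simp add: algebra_simps)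
  qed
  have bound: "\<bar>f (a + u * (b - a)) - f (a' + u * (b - a'))\<bar> \<le> K * \<bar>a - a'\<bar>"
    if "0 \<le> u" "u \<le> 1" for u
  proof -
    have "\<bar>f (a + u * (b - a)) - f (a' + u * (b - a'))\<bar>
      \<le> K * \<bar>(a + u * (b - a)) - (a' + u * (b - a'))\<bar>"
      using that assms by (intro lip seg) auto
    also have "(a + u * (b - a)) - (a' + u * (b - a')) = (1 - u) * (a - a')"
      by (simp add: algebra_simps)
    also have "\<bar>\<dots>\<bar> \<le> \<bar>a - a'\<bar>"
      using that by (simp add: abs_mult mult_left_le_one_le)
    finally show ?thesis using K by (simp add: mult_left_mono)
  qed
  have "avg f a b - avg f a' b = integral {0..1} (\<lambda>u. f (a + u * (b - a)) - f (a' + u * (b - a')))"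
    unfolding avg_def by (intro integral_diff[symmetric] avg_integrand_integrable cont)
  also have "\<bar>\<dots>\<bar> \<le> integral {0..1::real} (\<lambda>_. K * \<bar>a - a'\<bar>)"
    unfolding real_norm_def[symmetric]
    by (rule integral_norm_bound_integral)
       (use bound in \<open>auto intro!: integrable_diff avg_integrand_integrable cont\<close>)
  finally show ?thesis by simp
qed

lemma wavg_nonpos:
  assumes "\<And>y. f y \<le> 0" "continuous_on UNIV f"
  shows "wavg f a b \<le> 0"
proof -
  have "wavg f a b \<le> integral {0..1} (\<lambda>_::real. 0)"
    unfolding wavg_def
    by (intro integral_le wavg_integrand_integrable assms) (auto intro: mult_nonneg_nonpos assms)
  then show ?thesis by simp
qed

text \<open>Exhaustion by compact intervals extends the substitution rule to the whole line.\<close>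

lemma nn_integral_substitution_line:
  fixes f :: "real \<Rightarrow> ennreal" and g g' :: "real \<Rightarrow> real"
  assumes [measurable]: "f \<in> borel_measurable borel"
    and der: "\<And>x. (g has_real_derivative g' x) (at x)"
    and cont: "continuous_on UNIV g'"
    and nonneg: "\<And>x. g' x \<ge> 0"
    and surj: "surj g"
  shows "(\<integral>\<^sup>+x. f x \<partial>lborel) = (\<integral>\<^sup>+x. f (g x) * ennreal (g' x) \<partial>lborel)"
proof -
  have mono: "mono g"
    using DERIV_nonneg_imp_nondecreasing der nonneg by (intro monoI) blast
  have [measurable]: "g' \<in> borel_measurable borel" "g \<in> borel_measurable borel"
    using cont der by (auto intro!: borel_measurable_continuous_onI
        continuous_at_imp_continuous_on DERIV_isCont[OF der])
  \<comment> \<open>\<open>Suc n\<close> in place of \<open>n\<close> keeps every interval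
    nondegenerate.\<close>
  let ?A = "\<lambda>n::nat. {g (- real (Suc n))..g (real (Suc n))}"
  let ?B = "\<lambda>n::nat. {- real (Suc n)..real (Suc n)}"
  have eq: "(\<integral>\<^sup>+x. f x * indicator (?A n) x \<partial>lborel)
          = (\<integral>\<^sup>+x. f (g x) * g' x * indicator (?B n) x \<partial>lborel)" for n
    by (rule nn_integral_substitution_aux)
       (simp_all add: der nonneg continuous_on_subset[OF cont])
  have lim: "(\<lambda>n. \<integral>\<^sup>+x. h x * indicator (I n) x \<partial>lborel) \<longlonglongrightarrow> (\<integral>\<^sup>+x. h x \<partial>lborel)"
    if [measurable]: "h \<in> borel_measurable borel" "\<And>n. I n \<in> sets borel"
      and I: "incseq I" "(\<Union>n. I n) = UNIV" for h :: "real \<Rightarrow> ennreal" and I :: "nat \<Rightarrow> real set"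
  proof (rule nn_integral_LIMSEQ)
    show "incseq (\<lambda>n x. h x * indicator (I n) x)"
      using I by (auto simp: incseq_def le_fun_def indicator_def split: if_splits)
    show "(\<lambda>n. h x * indicator (I n) x) \<longlonglongrightarrow> h x" for x
    proof (rule tendsto_eventually)
      obtain N where "x \<in> I N" using I by blast
      then have "x \<in> I n" if "n \<ge> N" for n using I(1) that by (auto simp: incseq_def)
      then show "eventually (\<lambda>n. h x * indicator (I n) x = h x) sequentially"
        by (auto simp: eventually_sequentially indicator_def)
    qed
  qed measurable
  have B: "(\<Union>n. ?B n) = UNIV"
  proof -
    have "\<exists>n. x \<in> ?B n" for x
    proof -
      obtain n where "\<bar>x\<bar> \<le> real n" using real_arch_simple by blast
      then have "x \<in> ?B n" by auto
      then show ?thesis ..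
    qed
    then show ?thesis by blast
  qed
  \<comment> \<open>The images exhaust the line because \<open>g\<close> is onto: a preimage of
    \<open>y\<close> lies in some \<open>?B n\<close>, and monotonicity puts \<open>y\<close>
    between the images of the ends.\<close>
  have A: "(\<Union>n. ?A n) = UNIV"
  proof -
    have "\<exists>n. y \<in> ?A n" for y
    proof -
      obtain x where "y = g x" using surj by blast
      moreover obtain n where "x \<in> ?B n" using B by blast
      ultimately have "y \<in> ?A n" using mono by (simp add: monoD)
      then show ?thesis ..
    qed
    then show ?thesis by blast
  qed
  have "incseq ?B" by (auto simp: incseq_def)
  moreover have "incseq ?A"
  proof (rule incseq_SucI)
    fix n
    have "g (- real (Suc (Suc n))) \<le> g (- real (Suc n))" "g (real (Suc n)) \<le> g (real (Suc (Suc n)))"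
      by (intro monoD[OF mono], simp)+
    then show "?A n \<subseteq> ?A (Suc n)" by auto
  qed
  ultimately have
      "(\<lambda>n. \<integral>\<^sup>+x. f x * indicator (?A n) x \<partial>lborel) \<longlonglongrightarrow> (\<integral>\<^sup>+x. f x \<partial>lborel)"
      "(\<lambda>n. \<integral>\<^sup>+x. f (g x) * ennreal (g' x) * indicator (?B n) x \<partial>lborel)
        \<longlonglongrightarrow> (\<integral>\<^sup>+x. f (g x) * ennreal (g' x) \<partial>lborel)"
    using A B by (intro lim; simp)+
  then show ?thesis
    unfolding eq by (rule LIMSEQ_unique)
qed

section \<open>The implicit discrete-gradient scheme\<close>

locale gradient_drift =
  fixes L l l' :: "real \<Rightarrow> real"
  assumes L_deriv: "\<And>y. (L has_real_derivative l y) (at y)"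
    and l_deriv: "\<And>y. (l has_real_derivative l' y) (at y)"
    and l'_cont: "continuous_on UNIV l'"
    and l'_nonpos: "\<And>y. l' y \<le> 0"
begin

lemma l_cont: "continuous_on UNIV l"
  by (intro continuous_at_imp_continuous_on ballI DERIV_isCont[OF l_deriv])

lemma L_cont: "continuous_on UNIV L"
  by (intro continuous_at_imp_continuous_on ballI DERIV_isCont[OF L_deriv])

lemma l_antimono: "antimono l"
proof (rule antimonoI)
  fix y z :: real assume "y \<le> z"
  then show "l z \<le> l y"
    using DERIV_nonpos_imp_nonincreasing[of y z l] l_deriv l'_nonpos by blast
qed

text \<open>The implicit equation solved for the noise: the increment that carries \<open>a\<close>
  to \<open>b\<close>. It is explicit in \<open>b\<close>, so the law of a step is found by
  substituting with \<open>gap\<close>, and \<open>implicit_step\<close> never has to be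
  differentiated.\<close>

definition gap :: "real \<Rightarrow> real \<Rightarrow> real \<Rightarrow> real" where
  "gap h a b = b - a - h * avg l a b"

definition implicit_step :: "real \<Rightarrow> real \<Rightarrow> real \<Rightarrow> real" where
  "implicit_step h a v = (THE b. gap h a b = v)"

definition step_density :: "real \<Rightarrow> real \<Rightarrow> real \<Rightarrow> real \<Rightarrow> real" where
  "step_density h \<sigma> a b =
     exp ((L b - L a) / \<sigma>\<^sup>2 - h * (avg l a b)\<^sup>2 / (2 * \<sigma>\<^sup>2)) * (1 - h * wavg l' a b)"

lemma gap_deriv: "((\<lambda>b. gap h a b) has_real_derivative (1 - h * wavg l' a b)) (at b)"
  unfolding gap_def
  by (auto intro!: derivative_eq_intros has_real_derivative_avg[OF l_deriv l'_cont])

text \<open>A decreasing drift pushes the Jacobian upwards, so the step is invertible without any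
  smallness condition on the mesh.\<close>

lemma one_minus_wavg_ge_1: "h \<ge> 0 \<Longrightarrow> 1 - h * wavg l' a b \<ge> 1"
  using wavg_nonpos[OF l'_nonpos l'_cont, of a b] by (simp add: mult_nonneg_nonpos)

lemma step_density_nonneg: "h \<ge> 0 \<Longrightarrow> step_density h \<sigma> a b \<ge> 0"
  using one_minus_wavg_ge_1[of h a b] by (simp add: step_density_def)

lemma gap_strict_mono: "h \<ge> 0 \<Longrightarrow> strict_mono (gap h a)"
proof (rule strict_monoI)
  fix b b' :: real assume "h \<ge> 0" "b < b'"
  have "\<exists>y. (gap h a has_real_derivative y) (at u) \<and> y > 0" for u
    using gap_deriv[of h a u] one_minus_wavg_ge_1[OF \<open>h \<ge> 0\<close>, of a u] by fastforce
  then show "gap h a b < gap h a b'"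
    using DERIV_pos_imp_increasing[OF \<open>b < b'\<close>] by blast
qed

lemma gap_le_iff: "h \<ge> 0 \<Longrightarrow> gap h a b \<le> gap h a c \<longleftrightarrow> b \<le> c"
  by (rule strict_mono_less_eq[OF gap_strict_mono])

lemma gap_surj: assumes "h \<ge> 0" shows "\<exists>b. gap h a b = v"
proof -
  have anti: "avg l a b' \<le> avg l a b" if "b \<le> b'" for b b'
    by (rule avg_antimono[OF l_antimono l_cont _ that]) simp
  \<comment> \<open>\<open>C\<close> is chosen for the intermediate value theorem: as
    \<open>avg l a\<close> decreases, its value at \<open>C\<close> is at most that at 0, whence
    \<open>gap h a C\<close> is at least \<open>C - a - h * avg l a 0\<close>, which is at least
    \<open>v\<close>. The estimate at \<open>- C\<close> is symmetric.\<close>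
  define C where "C = \<bar>a\<bar> + h * \<bar>avg l a 0\<bar> + \<bar>v\<bar>"
  have "C \<ge> 0" using assms by (simp add: C_def)
  have h: "\<bar>h * avg l a 0\<bar> \<le> h * \<bar>avg l a 0\<bar>" using assms by (simp add: abs_mult)
  have "h * avg l a C \<le> h * avg l a 0" "h * avg l a 0 \<le> h * avg l a (- C)"
    using assms \<open>C \<ge> 0\<close> by (auto intro!: mult_left_mono anti)
  then have "gap h a (- C) \<le> v" "v \<le> gap h a C"
    using h unfolding gap_def C_def by linarith+
  moreover have "- C \<le> C" using \<open>C \<ge> 0\<close> by simp
  moreover have "continuous_on {- C..C} (gap h a)"
    by (intro continuous_at_imp_continuous_on ballI DERIV_isCont[OF gap_deriv])
  ultimately show ?thesis
    using IVT'[of "gap h a" "- C" v C] by blast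
qed

lemma gap_implicit_step [simp]: "h \<ge> 0 \<Longrightarrow> gap h a (implicit_step h a v) = v"
proof -
  assume h: "h \<ge> 0"
  obtain b where b: "gap h a b = v" using gap_surj[OF h] by blast
  have "gap h a (THE b. gap h a b = v) = v"
    by (rule theI[of _ b]) (use b strict_mono_eq[OF gap_strict_mono[OF h]] in auto)
  then show ?thesis by (simp add: implicit_step_def)
qed

lemma implicit_step_gap [simp]: "h \<ge> 0 \<Longrightarrow> implicit_step h a (gap h a b) = b"
  using gap_implicit_step[of h a "gap h a b"] strict_mono_eq[OF gap_strict_mono] by blast

lemma implicit_step_eq:
  "h \<ge> 0 \<Longrightarrow> implicit_step h a v = a + h * avg l a (implicit_step h a v) + v"
  using gap_implicit_step[of h a v] by (simp add: gap_def)

lemma measurable_avg_l [measurable]: "(\<lambda>p. avg l (fst p) (snd p)) \<in> borel_measurable (borel \<Otimes>\<^sub>M borel)"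
  using borel_measurable_continuous_onI[OF continuous_on_avg[OF l_cont]] by (simp add: borel_prod)

lemma measurable_wavg_l' [measurable]: "(\<lambda>p. wavg l' (fst p) (snd p)) \<in> borel_measurable (borel \<Otimes>\<^sub>M borel)"
  using borel_measurable_continuous_onI[OF continuous_on_wavg[OF l'_cont]] by (simp add: borel_prod)

lemma measurable_L [measurable]: "L \<in> borel_measurable borel"
  by (rule borel_measurable_continuous_onI[OF L_cont])

lemma measurable_gap [measurable]: "(\<lambda>p. gap h (fst p) (snd p)) \<in> borel_measurable (borel \<Otimes>\<^sub>M borel)"
  unfolding gap_def by measurable

text \<open>By strict monotonicity of \<open>gap\<close>, the condition
  \<open>implicit_step h a v \<le> c\<close> amounts to \<open>v \<le> gap h a c\<close>, which
  involves only the explicit function. Joint measurability thus needs no regularity of the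
  inverse.\<close>

lemma measurable_implicit_step:
  assumes "h \<ge> 0"
  shows "(\<lambda>p. implicit_step h (fst p) (snd p)) \<in> borel_measurable (borel \<Otimes>\<^sub>M borel)"
  unfolding borel_measurable_iff_le
proof
  fix c :: real
  have "implicit_step h a v \<le> c \<longleftrightarrow> v \<le> gap h a c" for a v
    using gap_le_iff[OF assms, of a "implicit_step h a v" c] assms by simp
  moreover have "{w \<in> space (borel \<Otimes>\<^sub>M borel). snd w \<le> gap h (fst w) c} \<in> sets (borel \<Otimes>\<^sub>M borel)"
  proof -
    have [measurable]: "(\<lambda>w. gap h (fst w) c) \<in> borel_measurable (borel \<Otimes>\<^sub>M (borel :: real measure))"
    proof -
      have "(\<lambda>w. (fst w, c)) \<in> measurable (borel \<Otimes>\<^sub>M (borel :: real measure)) (borel \<Otimes>\<^sub>M borel)"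
        by measurable
      from measurable_compose[OF this measurable_gap[of h]] show ?thesis by simp
    qed
    show ?thesis by measurable
  qed
  ultimately show "{w \<in> space (borel \<Otimes>\<^sub>M borel). implicit_step h (fst w) (snd w) \<le> c} \<in> sets (borel \<Otimes>\<^sub>M borel)"
    by simp
qed

lemma measurable_step_density:
  "(\<lambda>p. step_density h \<sigma> (fst p) (snd p)) \<in> borel_measurable (borel \<Otimes>\<^sub>M borel)"
  unfolding step_density_def by measurable

text \<open>Expand the square of \<open>(b - a) - h * avg l a b\<close> in the Gaussian exponent.
  The mesh cancels in the cross term, which becomes
  \<open>avg l a b * (b - a) / \<sigma>\<^sup>2\<close>, that is, the increment of
  \<open>L\<close>.\<close>

lemma step_density_eq:
  assumes "h > 0" "\<sigma> > 0"
  shows "normal_density 0 (sqrt h) (gap h a b / \<sigma>) * (1 - h * wavg l' a b) =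
         normal_density 0 (sqrt h) ((b - a) / \<sigma>) * step_density h \<sigma> a b"
proof -
  have L: "L b - L a = avg l a b * (b - a)"
    by (rule avg_mult_diff[OF L_deriv, symmetric])
  have "- (gap h a b / \<sigma>)\<^sup>2 / (2 * h) = - ((b - a) / \<sigma>)\<^sup>2 / (2 * h) +
          ((L b - L a) / \<sigma>\<^sup>2 - h * (avg l a b)\<^sup>2 / (2 * \<sigma>\<^sup>2))"
    unfolding gap_def L using assms by (simp add: field_simps power2_eq_square)
  then have "exp (- (gap h a b / \<sigma>)\<^sup>2 / (2 * h)) = exp (- ((b - a) / \<sigma>)\<^sup>2 / (2 * h)) *
          exp ((L b - L a) / \<sigma>\<^sup>2 - h * (avg l a b)\<^sup>2 / (2 * \<sigma>\<^sup>2))"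
    by (simp only: exp_add)
  then show ?thesis
    using assms by (simp add: normal_density_def step_density_def)
qed

text \<open>Substituting \<open>v = gap h a b / \<sigma>\<close> makes the new position
  \<open>b\<close> the integration variable, where the two densities can be compared pointwise by
  \<open>step_density_eq\<close>. The starting point \<open>a\<close> is arbitrary, as is needed for
  chaining.\<close>

lemma implicit_step_change_of_measure:
  assumes h: "h > 0" and \<sigma>: "\<sigma> > 0" and F [measurable]: "F \<in> borel_measurable borel"
  shows "(\<integral>\<^sup>+v. F (implicit_step h a (\<sigma> * v)) \<partial>density lborel (normal_density 0 (sqrt h))) =
         (\<integral>\<^sup>+v. ennreal (step_density h \<sigma> a (a + \<sigma> * v)) * F (a + \<sigma> * v)
            \<partial>density lborel (normal_density 0 (sqrt h)))"
proof -
  let ?p = "normal_density 0 (sqrt h)"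
  have [measurable]: "(\<lambda>v. implicit_step h a v) \<in> borel_measurable borel"
    using measurable_compose[OF _ measurable_implicit_step[of h], of "\<lambda>v. (a, v)" borel] h by simp
  have [measurable]: "(\<lambda>b. step_density h \<sigma> a b) \<in> borel_measurable borel"
    using measurable_compose[OF _ measurable_step_density[of h \<sigma>], of "\<lambda>v. (a, v)" borel] by simp
  have "(\<integral>\<^sup>+v. F (implicit_step h a (\<sigma> * v)) \<partial>density lborel ?p) =
        (\<integral>\<^sup>+v. ?p v * F (implicit_step h a (\<sigma> * v)) \<partial>lborel)"
    by (subst nn_integral_density) auto
  also have "\<dots> = (\<integral>\<^sup>+b. (?p (gap h a b / \<sigma>) * F (implicit_step h a (\<sigma> * (gap h a b / \<sigma>)))) *
                     ennreal ((1 - h * wavg l' a b) / \<sigma>) \<partial>lborel)"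
  proof (rule nn_integral_substitution_line)
    show "((\<lambda>b. gap h a b / \<sigma>) has_real_derivative (1 - h * wavg l' a b) / \<sigma>) (at b)" for b
      by (rule DERIV_cdivide[OF gap_deriv])
    have "continuous_on UNIV (\<lambda>b. wavg l' (fst (a, b)) (snd (a, b)))"
      by (rule continuous_on_compose2[OF continuous_on_wavg[OF l'_cont]]) (auto intro!: continuous_intros)
    then show "continuous_on UNIV (\<lambda>b. (1 - h * wavg l' a b) / \<sigma>)"
      using \<sigma> by (auto intro!: continuous_intros)
    show "0 \<le> (1 - h * wavg l' a b) / \<sigma>" for b
      using \<sigma> h one_minus_wavg_ge_1[of h a b] by simp
    show "surj (\<lambda>b. gap h a b / \<sigma>)"
    proof (rule surjI)
      show "gap h a (implicit_step h a (\<sigma> * v)) / \<sigma> = v" for v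
        using h \<sigma> by simp
    qed
  qed simp
  also have "\<dots> = (\<integral>\<^sup>+b. (?p ((b - a) / \<sigma>) * (ennreal (step_density h \<sigma> a (a + \<sigma> * ((b - a) / \<sigma>))) *
        F (a + \<sigma> * ((b - a) / \<sigma>)))) * ennreal (1 / \<sigma>) \<partial>lborel)"
  proof (rule nn_integral_cong)
    fix b
    have "ennreal (?p (gap h a b / \<sigma>)) * ennreal ((1 - h * wavg l' a b) / \<sigma>) =
          ennreal (?p ((b - a) / \<sigma>)) * ennreal (step_density h \<sigma> a b) * ennreal (1 / \<sigma>)"
      using step_density_eq[OF h \<sigma>, of a b] h \<sigma> one_minus_wavg_ge_1[of h a b]
        step_density_nonneg[of h \<sigma> a b]
      by (simp flip: ennreal_mult)
    then show "(?p (gap h a b / \<sigma>) * F (implicit_step h a (\<sigma> * (gap h a b / \<sigma>)))) *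
          ennreal ((1 - h * wavg l' a b) / \<sigma>) =
        (?p ((b - a) / \<sigma>) * (ennreal (step_density h \<sigma> a (a + \<sigma> * ((b - a) / \<sigma>))) *
        F (a + \<sigma> * ((b - a) / \<sigma>)))) * ennreal (1 / \<sigma>)"
      using h \<sigma> by (simp add: mult.assoc mult.left_commute mult.commute)
  qed
  \<comment> \<open>The substitution rule read backwards, for the affine map whose inverse is the
    driftless step \<open>a + \<sigma> * v\<close>.\<close>
  also have "\<dots> = (\<integral>\<^sup>+v. ?p v * (ennreal (step_density h \<sigma> a (a + \<sigma> * v)) * F (a + \<sigma> * v)) \<partial>lborel)"
  proof (rule nn_integral_substitution_line[symmetric])
    show "((\<lambda>b. (b - a) / \<sigma>) has_real_derivative 1 / \<sigma>) (at b)" for b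
      using \<sigma> by (auto intro!: derivative_eq_intros)
    show "surj (\<lambda>b. (b - a) / \<sigma>)"
      by (rule surjI[of _ "\<lambda>v. a + \<sigma> * v"]) (use \<sigma> in simp)
  qed (use \<sigma> in auto)
  also have "\<dots> = (\<integral>\<^sup>+v. ennreal (step_density h \<sigma> a (a + \<sigma> * v)) * F (a + \<sigma> * v) \<partial>density lborel ?p)"
    by (subst nn_integral_density) auto
  finally show ?thesis .
qed

end

section \<open>Chains driven by a noise sequence\<close>

primrec iterate_noise :: "(real \<Rightarrow> real \<Rightarrow> real) \<Rightarrow> real \<Rightarrow> (nat \<Rightarrow> real) \<Rightarrow> nat \<Rightarrow> real" where
  "iterate_noise g x v 0 = x"
| "iterate_noise g x v (Suc k) = g (iterate_noise g x v k) (v k)"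

lemma iterate_noise_cong:
  "(\<And>j. j < k \<Longrightarrow> v j = v' j) \<Longrightarrow> iterate_noise g x v k = iterate_noise g x v' k"
  by (induction k) auto

lemma iterate_noise_fun_upd [simp]:
  "k \<le> n \<Longrightarrow> iterate_noise g x (v(n := y)) k = iterate_noise g x v k"
  by (rule iterate_noise_cong) auto

lemma measurable_iterate_noise:
  assumes g: "(\<lambda>p. g (fst p) (snd p)) \<in> borel_measurable (borel \<Otimes>\<^sub>M borel)" and "k \<le> n"
    and N: "\<And>j. sets (N j) = sets borel"
  shows "(\<lambda>v. iterate_noise g x v k) \<in> borel_measurable (PiM {..<n} N)"
  using \<open>k \<le> n\<close>
proof (induction k)
  case (Suc k)
  have "(\<lambda>v. v k) \<in> measurable (PiM {..<n} N) (N k)"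
    using Suc.prems by (intro measurable_component_singleton) auto
  then have "(\<lambda>v. v k) \<in> borel_measurable (PiM {..<n} N)"
    using measurable_cong_sets[OF refl N[of k]] by blast
  then show ?case
    using measurable_compose[OF measurable_Pair[OF Suc.IH] g] Suc.prems by simp
qed simp

text \<open>A one-step change of measure, valid from every starting point, propagates along a chain
  because the last step can be integrated out conditionally on the previous ones.\<close>

lemma chain_change_of_measure:
  fixes N :: "real measure" and d :: "real \<Rightarrow> real \<Rightarrow> ennreal"
  assumes "prob_space N" and N [measurable_cong]: "sets N = sets borel"
    and g1 [measurable]: "(\<lambda>p. g1 (fst p) (snd p)) \<in> borel_measurable (borel \<Otimes>\<^sub>M borel)"
    and g2 [measurable]: "(\<lambda>p. g2 (fst p) (snd p)) \<in> borel_measurable (borel \<Otimes>\<^sub>M borel)"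
    and d [measurable]: "(\<lambda>p. d (fst p) (snd p)) \<in> borel_measurable (borel \<Otimes>\<^sub>M borel)"
    and step: "\<And>a F. F \<in> borel_measurable borel \<Longrightarrow>
        (\<integral>\<^sup>+v. F (g1 a v) \<partial>N) = (\<integral>\<^sup>+v. d a (g2 a v) * F (g2 a v) \<partial>N)"
    and f: "f \<in> borel_measurable (PiM {..n} (\<lambda>_. borel))"
  shows "(\<integral>\<^sup>+v. f (restrict (iterate_noise g1 x v) {..n}) \<partial>PiM {..<n} (\<lambda>_. N)) =
         (\<integral>\<^sup>+v. (\<Prod>k<n. d (iterate_noise g2 x v k) (iterate_noise g2 x v (Suc k))) *
             f (restrict (iterate_noise g2 x v) {..n}) \<partial>PiM {..<n} (\<lambda>_. N))"
  using f
proof (induction n arbitrary: f)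
  case 0
  have "restrict (iterate_noise g1 x v) {..0} = restrict (iterate_noise g2 x v) {..0}" for v
    by (auto simp: restrict_def fun_eq_iff)
  then show ?case by simp
next
  case (Suc n)
  note f [measurable] = Suc.prems
  interpret prob_space N by fact
  interpret product_sigma_finite "\<lambda>_::nat. N" ..
  let ?P = "PiM {..n} (\<lambda>_. borel :: real measure)"
  have upd: "(\<lambda>p. (fst p)(Suc n := snd p)) \<in> measurable (?P \<Otimes>\<^sub>M borel) (PiM {..Suc n} (\<lambda>_. borel))"
    using measurable_fun_upd[of "{..Suc n}" "{..n}" "Suc n" fst "?P \<Otimes>\<^sub>M borel" "\<lambda>_. borel" snd]
    by (auto simp: atMost_Suc)
  have f_upd: "(\<lambda>p. f ((fst p)(Suc n := snd p))) \<in> borel_measurable (?P \<Otimes>\<^sub>M borel)"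
    by (rule measurable_compose[OF upd f])
  have path: "(\<lambda>v. restrict (iterate_noise g x v) {..k}) \<in>
      measurable (PiM {..<m} (\<lambda>_. N)) (PiM {..k} (\<lambda>_. borel))"
    if "(\<lambda>p. g (fst p) (snd p)) \<in> borel_measurable (borel \<Otimes>\<^sub>M borel)" "k \<le> m" for g m k
    by (rule measurable_restrict, rule measurable_iterate_noise) (use that N in auto)
  have dens: "(\<lambda>v. d (iterate_noise g2 x v k) (iterate_noise g2 x v (Suc k)))
      \<in> borel_measurable (PiM {..<m} (\<lambda>_. N))" if "Suc k \<le> m" for k m
  proof -
    have "(\<lambda>v. (iterate_noise g2 x v k, iterate_noise g2 x v (Suc k)))
        \<in> measurable (PiM {..<m} (\<lambda>_. N)) (borel \<Otimes>\<^sub>M borel)"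
      by (intro measurable_Pair measurable_iterate_noise g2) (use that N in auto)
    from measurable_compose[OF this d] show ?thesis by simp
  qed
  have ins: "{..<Suc n} = insert n {..<n}" by auto
  have rs: "restrict (iterate_noise g x (v(n := y))) {..Suc n} =
      (restrict (iterate_noise g x v) {..n})(Suc n := g (iterate_noise g x v n) y)" for g v y
    by (auto simp: restrict_def fun_eq_iff le_Suc_eq)
  \<comment> \<open>\<open>f'\<close> is \<open>f\<close> with its last point already generated by
    the driftless step and weighted by \<open>d\<close>. It depends on the points up to index
    \<open>n\<close> only, so the induction hypothesis, which is general in \<open>f\<close>, treats
    all earlier steps.\<close>
  define f' where "f' z = (\<integral>\<^sup>+y. d (z n) (g2 (z n) y) * f (z(Suc n := g2 (z n) y)) \<partial>N)" for z
  have last_step: "(\<lambda>p. d (fst p n) (g2 (fst p n) (snd p)) * f ((fst p)(Suc n := g2 (fst p n) (snd p))))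
      \<in> borel_measurable (?P \<Otimes>\<^sub>M N)"
  proof -
    have "(\<lambda>p. (fst p n, snd p)) \<in> measurable (?P \<Otimes>\<^sub>M N) (borel \<Otimes>\<^sub>M borel)"
      by measurable
    from measurable_compose[OF this g2]
    have [measurable]: "(\<lambda>p. g2 (fst p n) (snd p)) \<in> borel_measurable (?P \<Otimes>\<^sub>M N)" by simp
    have "(\<lambda>p. (fst p n, g2 (fst p n) (snd p))) \<in> measurable (?P \<Otimes>\<^sub>M N) (borel \<Otimes>\<^sub>M borel)"
      by measurable
    from measurable_compose[OF this d]
    have 1: "(\<lambda>p. d (fst p n) (g2 (fst p n) (snd p))) \<in> borel_measurable (?P \<Otimes>\<^sub>M N)" by simp
    have "(\<lambda>p. (fst p, g2 (fst p n) (snd p))) \<in> measurable (?P \<Otimes>\<^sub>M N) (?P \<Otimes>\<^sub>M borel)"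
      by measurable
    from measurable_compose[OF this f_upd]
    have 2: "(\<lambda>p. f ((fst p)(Suc n := g2 (fst p n) (snd p)))) \<in> borel_measurable (?P \<Otimes>\<^sub>M N)" by simp
    show ?thesis by (rule borel_measurable_times_ennreal[OF 1 2])
  qed
  have f': "f' \<in> borel_measurable ?P"
    unfolding f'_def
    by (rule borel_measurable_nn_integral) (use last_step in \<open>simp add: case_prod_beta\<close>)
  have "(\<integral>\<^sup>+v. f (restrict (iterate_noise g1 x v) {..Suc n}) \<partial>PiM {..<Suc n} (\<lambda>_. N)) =
    (\<integral>\<^sup>+v. \<integral>\<^sup>+y. f (restrict (iterate_noise g1 x (v(n := y))) {..Suc n}) \<partial>N \<partial>PiM {..<n} (\<lambda>_. N))"
  proof -
    have "(\<lambda>v. f (restrict (iterate_noise g1 x v) {..Suc n})) \<in> borel_measurable (PiM {..<Suc n} (\<lambda>_. N))"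
      by (rule measurable_compose[OF path[OF g1 order_refl] f])
    then show ?thesis
      unfolding ins by (intro product_nn_integral_insert) auto
  qed
  also have "\<dots> = (\<integral>\<^sup>+v. f' (restrict (iterate_noise g1 x v) {..n}) \<partial>PiM {..<n} (\<lambda>_. N))"
  proof (rule nn_integral_cong)
    fix v
    let ?z = "restrict (iterate_noise g1 x v) {..n}"
    have "(\<lambda>b. (?z, b)) \<in> measurable borel (?P \<Otimes>\<^sub>M borel)"
      by (intro measurable_Pair) (auto simp: space_PiM)
    from measurable_compose[OF this f_upd]
    have "(\<lambda>b. f (?z(Suc n := b))) \<in> borel_measurable borel" by simp
    \<comment> \<open>The path up to index \<open>n\<close> is frozen, so the one-step identity
      applies with its last point as the start.\<close>
    from step[OF this, of "?z n"]
    show "(\<integral>\<^sup>+y. f (restrict (iterate_noise g1 x (v(n := y))) {..Suc n}) \<partial>N) = f' ?z"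
      unfolding rs f'_def by simp
  qed
  also have "\<dots> = (\<integral>\<^sup>+v. (\<Prod>k<n. d (iterate_noise g2 x v k) (iterate_noise g2 x v (Suc k))) *
             f' (restrict (iterate_noise g2 x v) {..n}) \<partial>PiM {..<n} (\<lambda>_. N))"
    by (rule Suc.IH[OF f'])
  also have "\<dots> = (\<integral>\<^sup>+v. \<integral>\<^sup>+y. (\<Prod>k<Suc n. d (iterate_noise g2 x (v(n := y)) k)
                 (iterate_noise g2 x (v(n := y)) (Suc k))) *
             f (restrict (iterate_noise g2 x (v(n := y))) {..Suc n}) \<partial>N \<partial>PiM {..<n} (\<lambda>_. N))"
  proof (rule nn_integral_cong)
    fix v
    let ?z = "restrict (iterate_noise g2 x v) {..n}"
    \<comment> \<open>The earlier factors do not see the noise coordinate \<open>n\<close> and are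
      constants for the inner integral.\<close>
    let ?c = "\<Prod>k<n. d (iterate_noise g2 x v k) (iterate_noise g2 x v (Suc k))"
    have "(\<lambda>b. (?z, b)) \<in> measurable N (?P \<Otimes>\<^sub>M N)"
      by (intro measurable_Pair) (auto simp: space_PiM)
    from measurable_compose[OF this last_step]
    have m: "(\<lambda>y. d (?z n) (g2 (?z n) y) * f (?z(Suc n := g2 (?z n) y))) \<in> borel_measurable N" by simp
    have "?c * f' ?z = (\<integral>\<^sup>+y. ?c * (d (?z n) (g2 (?z n) y) * f (?z(Suc n := g2 (?z n) y))) \<partial>N)"
      unfolding f'_def by (rule nn_integral_cmult[symmetric, OF m])
    also have "\<dots> = (\<integral>\<^sup>+y. (\<Prod>k<Suc n. d (iterate_noise g2 x (v(n := y)) k)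
                 (iterate_noise g2 x (v(n := y)) (Suc k))) *
             f (restrict (iterate_noise g2 x (v(n := y))) {..Suc n}) \<partial>N)"
    proof (rule nn_integral_cong)
      fix y
      have "(\<Prod>k<n. d (iterate_noise g2 x (v(n := y)) k) (iterate_noise g2 x (v(n := y)) (Suc k))) = ?c"
        by (rule prod.cong) (auto simp del: iterate_noise.simps)
      then show "?c * (d (?z n) (g2 (?z n) y) * f (?z(Suc n := g2 (?z n) y))) =
          (\<Prod>k<Suc n. d (iterate_noise g2 x (v(n := y)) k) (iterate_noise g2 x (v(n := y)) (Suc k))) *
             f (restrict (iterate_noise g2 x (v(n := y))) {..Suc n})"
        unfolding rs by (simp add: mult.assoc)
    qed
    finally show "?c * f' ?z = (\<integral>\<^sup>+y. (\<Prod>k<Suc n. d (iterate_noise g2 x (v(n := y)) k)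
                 (iterate_noise g2 x (v(n := y)) (Suc k))) *
             f (restrict (iterate_noise g2 x (v(n := y))) {..Suc n}) \<partial>N)" .
  qed
  also have "\<dots> = (\<integral>\<^sup>+v. (\<Prod>k<Suc n. d (iterate_noise g2 x v k) (iterate_noise g2 x v (Suc k))) *
             f (restrict (iterate_noise g2 x v) {..Suc n}) \<partial>PiM {..<Suc n} (\<lambda>_. N))"
  proof -
    have "(\<lambda>v. (\<Prod>k<Suc n. d (iterate_noise g2 x v k) (iterate_noise g2 x v (Suc k))) *
             f (restrict (iterate_noise g2 x v) {..Suc n})) \<in> borel_measurable (PiM {..<Suc n} (\<lambda>_. N))"
      by (intro borel_measurable_times_ennreal borel_measurable_prod_ennreal dens
            measurable_compose[OF path[OF g2 order_refl] f]) auto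
    then show ?thesis
      unfolding ins by (intro product_nn_integral_insert[symmetric]) auto
  qed
  finally show ?case .
qed

section \<open>Limits along uniform grids\<close>

text \<open>Uniform closeness at the grid points alone, so that no interpolation of the chains is
  needed. One notion covers both sides: the implicit scheme approaching the solution, and a sampled
  path, for which it is trivial.\<close>

definition grid_limit :: "real \<Rightarrow> (real \<Rightarrow> real) \<Rightarrow> (nat \<Rightarrow> nat \<Rightarrow> real) \<Rightarrow> bool" where
  "grid_limit T y z \<longleftrightarrow>
     (\<forall>\<epsilon>>0. \<forall>\<^sub>F n in sequentially. \<forall>k\<le>n. \<bar>z n k - y (T * real k / real n)\<bar> \<le> \<epsilon>)"

lemma grid_limit_self: "grid_limit T y (\<lambda>n k. y (T * real k / real n))"
  by (simp add: grid_limit_def)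

lemma grid_point_in:
  "T \<ge> 0 \<Longrightarrow> n > 0 \<Longrightarrow> k \<le> n \<Longrightarrow> T * real k / real n \<in> {0..T}"
  by (auto simp: field_simps mult_left_mono)

lemma grid_cell_subset:
  assumes "T \<ge> 0" "k < n"
  shows "{T * real k / real n..T * real (Suc k) / real n} \<subseteq> {0..T}"
  using grid_point_in[of T n k] grid_point_in[of T n "Suc k"] assms by auto

lemma grid_cell_width: "T * real (Suc k) / real n - T * real k / real n = T / real n"
  by (simp add: distrib_left add_divide_distrib)

lemma eventually_mesh_small:
  fixes T \<delta> :: real
  assumes "\<delta> > 0"
  shows "\<forall>\<^sub>F n in sequentially. n > 0 \<and> T / real n < \<delta>"
proof (rule eventually_conj)
  have "(\<lambda>n. T / real n) \<longlonglongrightarrow> 0"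
    by (rule lim_const_over_n)
  then show "\<forall>\<^sub>F n in sequentially. T / real n < \<delta>"
    using assms by (rule order_tendstoD)
qed (rule eventually_gt_at_top)

lemma continuous_on_abs_bound:
  fixes y :: "real \<Rightarrow> real"
  assumes "continuous_on {a..b} y"
  obtains B where "B \<ge> 0" "\<And>s. s \<in> {a..b} \<Longrightarrow> \<bar>y s\<bar> \<le> B"
proof -
  have "bounded (y ` {a..b})"
    by (intro compact_imp_bounded compact_continuous_image assms) simp
  then obtain B where "\<forall>s\<in>{a..b}. \<bar>y s\<bar> \<le> B" by (auto simp: bounded_iff)
  then show thesis using that[of "max B 0"] by (auto simp: le_max_iff_disj)
qed

text \<open>Neighbouring grid values merge in the limit, so only the diagonal of \<open>c\<close>
  survives. This rests on uniform continuity twice: of \<open>y\<close> on the time interval, and of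
  \<open>c\<close> on a compact square.\<close>

lemma grid_limit_cells:
  fixes c :: "real \<Rightarrow> real \<Rightarrow> real"
  assumes T: "T > 0" and y: "continuous_on {0..T} y"
    and c: "continuous_on UNIV (\<lambda>p. c (fst p) (snd p))"
    and z: "grid_limit T y z" and \<epsilon>: "\<epsilon> > 0"
  shows "\<forall>\<^sub>F n in sequentially. \<forall>k<n. \<forall>s\<in>{T * real k / real n..T * real (Suc k) / real n}.
           \<bar>c (z n k) (z n (Suc k)) - c (y s) (y s)\<bar> \<le> \<epsilon>"
proof -
  obtain B where B: "\<And>s. s \<in> {0..T} \<Longrightarrow> \<bar>y s\<bar> \<le> B"
    using continuous_on_abs_bound[OF y] by blast
  \<comment> \<open>The margin 1 leaves room for grid values that stray from the range of
    \<open>y\<close>.\<close>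
  let ?K = "{-(B+1)..B+1} \<times> {-(B+1)..B+1}"
  have "uniformly_continuous_on ?K (\<lambda>p. c (fst p) (snd p))"
    by (intro compact_uniformly_continuous compact_Times continuous_on_subset[OF c]) auto
  then obtain \<delta> where \<delta>: "\<delta> > 0" and
    unif: "\<And>p p'. p \<in> ?K \<Longrightarrow> p' \<in> ?K \<Longrightarrow> dist p' p < \<delta> \<Longrightarrow>
        \<bar>c (fst p') (snd p') - c (fst p) (snd p)\<bar> < \<epsilon>"
    using \<epsilon> unfolding uniformly_continuous_on_def dist_real_def by metis
  \<comment> \<open>Each coordinate is within \<open>2 * d\<close> of \<open>y s\<close>, one
    \<open>d\<close> for the scheme and one for the oscillation of \<open>y\<close>. The pair is
    then closer than \<open>4 * d < \<delta>\<close>, and \<open>2 * d \<le> 1\<close> keeps it in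
    \<open>?K\<close>.\<close>
  define d where "d = min (\<delta> / 5) (1 / 2)"
  have d: "d > 0" "4 * d < \<delta>" "2 * d \<le> 1" using \<delta> by (auto simp: d_def)
  have "uniformly_continuous_on {0..T} y"
    by (intro compact_uniformly_continuous y) simp
  then obtain \<eta> where \<eta>: "\<eta> > 0" and
    yunif: "\<And>s t. s \<in> {0..T} \<Longrightarrow> t \<in> {0..T} \<Longrightarrow> \<bar>t - s\<bar> < \<eta> \<Longrightarrow> \<bar>y t - y s\<bar> < d"
    using d(1) unfolding uniformly_continuous_on_def dist_real_def by metis
  have "\<forall>\<^sub>F n in sequentially. \<forall>k\<le>n. \<bar>z n k - y (T * real k / real n)\<bar> \<le> d"
    using z d(1) by (auto simp: grid_limit_def)
  with eventually_mesh_small[OF \<eta>, of T] show ?thesis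
  proof eventually_elim
    case (elim n)
    show ?case
    proof (intro allI impI ballI)
      fix k s assume k: "k < n" and s: "s \<in> {T * real k / real n..T * real (Suc k) / real n}"
      let ?a = "T * real k / real n" and ?b = "T * real (Suc k) / real n"
      have ab: "?a \<in> {0..T}" "?b \<in> {0..T}" "s \<in> {0..T}"
        using grid_point_in[of T n k] grid_point_in[of T n "Suc k"] grid_cell_subset[of T k n] T k s
        by (simp_all add: subset_iff del: atLeastAtMost_iff)
      have "\<bar>?a - s\<bar> < \<eta>" "\<bar>?b - s\<bar> < \<eta>"
        using s elim grid_cell_width[of T k n] by auto
      then have "\<bar>y ?a - y s\<bar> < d" "\<bar>y ?b - y s\<bar> < d"
        using yunif ab by auto
      moreover have "\<bar>z n k - y ?a\<bar> \<le> d" "\<bar>z n (Suc k) - y ?b\<bar> \<le> d"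
        using elim(2)[rule_format, of k] elim(2)[rule_format, of "Suc k"] k by simp_all
      ultimately have near: "\<bar>z n k - y s\<bar> < 2 * d" "\<bar>z n (Suc k) - y s\<bar> < 2 * d" by linarith+
      have "dist (z n k, z n (Suc k)) (y s, y s) \<le> \<bar>z n k - y s\<bar> + \<bar>z n (Suc k) - y s\<bar>"
        by (simp add: dist_Pair_Pair dist_real_def sqrt_sum_squares_le_sum_abs[simplified])
      then have "dist (z n k, z n (Suc k)) (y s, y s) < \<delta>" using near d by linarith
      moreover have "(z n k, z n (Suc k)) \<in> ?K" "(y s, y s) \<in> ?K"
        using near B[OF ab(3)] d by auto
      ultimately show "\<bar>c (z n k) (z n (Suc k)) - c (y s) (y s)\<bar> \<le> \<epsilon>"
        using unif[of "(y s, y s)" "(z n k, z n (Suc k))"] by simp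
    qed
  qed
qed

lemma integral_grid_sum:
  fixes f :: "real \<Rightarrow> real"
  assumes T: "T \<ge> 0" and f: "continuous_on {0..T} f" and "n > 0" "k \<le> n"
  shows "integral {0..T * real k / real n} f =
         (\<Sum>j<k. integral {T * real j / real n..T * real (Suc j) / real n} f)"
  using \<open>k \<le> n\<close>
proof (induction k)
  case (Suc k)
  have "{0..T * real (Suc k) / real n} \<subseteq> {0..T}"
    using grid_point_in[OF T \<open>n > 0\<close>, of "Suc k"] Suc.prems by auto
  then have "f integrable_on {0..T * real (Suc k) / real n}"
    by (intro integrable_continuous_interval continuous_on_subset[OF f])
  then have "integral {0..T * real k / real n} f +
      integral {T * real k / real n..T * real (Suc k) / real n} f = integral {0..T * real (Suc k) / real n} f"
    using T by (intro Henstock_Kurzweil_Integration.integral_combine) (auto intro!: divide_right_mono mult_left_mono)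
  then show ?case using Suc by simp
qed simp

lemma integral_near_const:
  fixes f :: "real \<Rightarrow> real"
  assumes "u \<le> v" "continuous_on {u..v} f" "\<And>s. s \<in> {u..v} \<Longrightarrow> \<bar>c - f s\<bar> \<le> \<epsilon>"
  shows "\<bar>(v - u) * c - integral {u..v} f\<bar> \<le> (v - u) * \<epsilon>"
proof -
  have f: "f integrable_on {u..v}" using assms by (intro integrable_continuous_interval)
  have "(v - u) * c - integral {u..v} f = integral {u..v} (\<lambda>s. c - f s)"
    using assms by (subst integral_diff) (auto intro: f)
  also have "\<bar>\<dots>\<bar> \<le> integral {u..v} (\<lambda>_. \<epsilon>)"
    unfolding real_norm_def[symmetric]
    by (rule integral_norm_bound_integral) (use assms f in \<open>auto intro!: integrable_diff\<close>)
  finally show ?thesis using assms by simp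
qed

lemma continuous_on_diagonal:
  assumes "continuous_on S y" "continuous_on UNIV (\<lambda>p. c (fst p) (snd p))"
  shows "continuous_on S (\<lambda>s. c (y s) (y s) :: real)"
proof -
  have "continuous_on S (\<lambda>s. (\<lambda>p. c (fst p) (snd p)) (y s, y s))"
    by (rule continuous_on_compose2[OF assms(2)]) (auto intro!: continuous_intros assms(1))
  then show ?thesis by simp
qed

lemma grid_limit_Riemann_sum:
  fixes c :: "real \<Rightarrow> real \<Rightarrow> real"
  assumes T: "T > 0" and y: "continuous_on {0..T} y"
    and c: "continuous_on UNIV (\<lambda>p. c (fst p) (snd p))"
    and z: "grid_limit T y z"
  shows "(\<lambda>n. T / real n * (\<Sum>k<n. c (z n k) (z n (Suc k)))) \<longlonglongrightarrow> integral {0..T} (\<lambda>s. c (y s) (y s))"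
proof (rule LIMSEQ_I)
  fix r :: real assume r: "r > 0"
  let ?f = "\<lambda>s. c (y s) (y s)"
  have f: "continuous_on {0..T} ?f" by (rule continuous_on_diagonal[OF y c])
  \<comment> \<open>The cells have total length \<open>T\<close>, so the accumulated error is at
    most \<open>r / 2\<close>.\<close>
  define \<epsilon> where "\<epsilon> = r / (2 * T)"
  have \<epsilon>: "\<epsilon> > 0" using r T by (simp add: \<epsilon>_def)
  have "\<forall>\<^sub>F n in sequentially. norm (T / real n * (\<Sum>k<n. c (z n k) (z n (Suc k))) - integral {0..T} ?f) < r"
    using grid_limit_cells[OF T y c z \<epsilon>] eventually_gt_at_top[of 0]
  proof eventually_elim
    case (elim n)
    let ?I = "\<lambda>k. integral {T * real k / real n..T * real (Suc k) / real n} ?f"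
    have "integral {0..T} ?f = (\<Sum>k<n. ?I k)"
      using integral_grid_sum[of T ?f n n] T f elim by simp
    then have "T / real n * (\<Sum>k<n. c (z n k) (z n (Suc k))) - integral {0..T} ?f =
        (\<Sum>k<n. T / real n * c (z n k) (z n (Suc k)) - ?I k)"
      by (simp add: sum_subtractf sum_distrib_left)
    also have "\<bar>\<dots>\<bar> \<le> (\<Sum>k<n. T / real n * \<epsilon>)"
    proof (rule order.trans[OF sum_abs sum_mono])
      fix k assume k: "k \<in> {..<n}"
      have "\<bar>(T * real (Suc k) / real n - T * real k / real n) * c (z n k) (z n (Suc k)) - ?I k\<bar>
          \<le> (T * real (Suc k) / real n - T * real k / real n) * \<epsilon>"
        using elim k T grid_cell_subset[of T k n]
        by (intro integral_near_const continuous_on_subset[OF f])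
           (auto intro!: divide_right_mono mult_left_mono)
      then show "\<bar>T / real n * c (z n k) (z n (Suc k)) - ?I k\<bar> \<le> T / real n * \<epsilon>"
        by (simp only: grid_cell_width)
    qed
    also have "\<dots> < r" using elim T r by (simp add: \<epsilon>_def)
    finally show ?case by simp
  qed
  then show "\<exists>no. \<forall>n\<ge>no. norm (T / real n * (\<Sum>k<n. c (z n k) (z n (Suc k))) - integral {0..T} ?f) < r"
    by (simp add: eventually_sequentially)
qed

text \<open>Take logarithms: \<open>ln (1 + u)\<close> differs from \<open>u\<close> by at most the
  square of \<open>u\<close>, and the \<open>n\<close> terms are of order 1/n uniformly, so the
  total error is of order 1/n. What remains is a Riemann sum.\<close>

lemma grid_limit_product:
  fixes m :: "real \<Rightarrow> real \<Rightarrow> real"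
  assumes T: "T > 0" and y: "continuous_on {0..T} y"
    and m: "continuous_on UNIV (\<lambda>p. m (fst p) (snd p))" and pos: "\<And>a b. m a b \<ge> 0"
    and z: "grid_limit T y z"
  shows "(\<lambda>n. \<Prod>k<n. 1 + T / real n * m (z n k) (z n (Suc k)))
           \<longlonglongrightarrow> exp (integral {0..T} (\<lambda>s. m (y s) (y s)))"
proof -
  let ?u = "\<lambda>n k. T / real n * m (z n k) (z n (Suc k))"
  have f: "continuous_on {0..T} (\<lambda>s. m (y s) (y s))" by (rule continuous_on_diagonal[OF y m])
  obtain B where B: "B \<ge> 0" "\<And>s. s \<in> {0..T} \<Longrightarrow> \<bar>m (y s) (y s)\<bar> \<le> B"
    using continuous_on_abs_bound[OF f] by blast
  have u0: "?u n k \<ge> 0" for n k using T pos by simp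
  \<comment> \<open>\<open>B\<close> bounds \<open>m\<close> on the diagonal along \<open>y\<close>;
    the additional 1 is the tolerance with which the cells are compared to the diagonal.\<close>
  have bound: "\<forall>\<^sub>F n in sequentially. \<forall>k<n. ?u n k \<le> T / real n * (B + 1)"
    using grid_limit_cells[OF T y m z zero_less_one]
  proof eventually_elim
    case (elim n)
    show ?case
    proof (intro allI impI mult_left_mono)
      fix k assume k: "k < n"
      let ?s = "T * real k / real n"
      have "?s \<in> {T * real k / real n..T * real (Suc k) / real n}"
        using T by (auto intro!: divide_right_mono)
      then have "\<bar>m (z n k) (z n (Suc k)) - m (y ?s) (y ?s)\<bar> \<le> 1" using elim k by blast
      moreover have "?s \<in> {0..T}" using grid_point_in[of T n k] T k by simp
      ultimately show "m (z n k) (z n (Suc k)) \<le> B + 1" using B(2)[of ?s] by linarith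
    qed (use T in simp)
  qed
  \<comment> \<open>A mesh below this value forces \<open>?u n k \<le> 1\<close>, the range in which
    the quadratic lower bound for the logarithm is valid.\<close>
  have B1: "1 / (B + 1) > 0" using B(1) by simp
  have "\<forall>\<^sub>F n in sequentially. \<bar>(\<Sum>k<n. ln (1 + ?u n k)) - (\<Sum>k<n. ?u n k)\<bar> \<le> (T * (B + 1))\<^sup>2 / real n"
    using bound eventually_mesh_small[OF B1, of T]
  proof eventually_elim
    case (elim n)
    have "(\<Sum>k<n. ln (1 + ?u n k)) - (\<Sum>k<n. ?u n k) = (\<Sum>k<n. ln (1 + ?u n k) - ?u n k)"
      by (simp add: sum_subtractf)
    also have "\<bar>\<dots>\<bar> \<le> (\<Sum>k<n. (T / real n * (B + 1))\<^sup>2)"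
    proof (rule order.trans[OF sum_abs sum_mono])
      fix k assume "k \<in> {..<n}"
      then have le: "?u n k \<le> T / real n * (B + 1)" using elim by auto
      have "T / real n * (B + 1) \<le> 1" 
      proof -
        have "T / real n < 1 / (B + 1)" using elim by blast
        then have "T / real n * (B + 1) < 1" using B(1) by (subst (asm) pos_less_divide_eq) auto
        then show ?thesis by simp
      qed
      then have "?u n k \<le> 1" using le by linarith
      then have "?u n k - (?u n k)\<^sup>2 \<le> ln (1 + ?u n k)" "ln (1 + ?u n k) \<le> ?u n k"
        using u0[of n k] ln_one_plus_pos_lower_bound[of "?u n k"] ln_add_one_self_le_self[of "?u n k"]
        by auto
      moreover have "(?u n k)\<^sup>2 \<le> (T / real n * (B + 1))\<^sup>2" using u0 le by (rule power_mono[rotated])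
      ultimately show "\<bar>ln (1 + ?u n k) - ?u n k\<bar> \<le> (T / real n * (B + 1))\<^sup>2" by linarith
    qed
    also have "\<dots> = (T * (B + 1))\<^sup>2 / real n"
      using elim by (simp add: power2_eq_square field_simps)
    finally show ?case .
  qed
  then have "(\<lambda>n. (\<Sum>k<n. ln (1 + ?u n k)) - (\<Sum>k<n. ?u n k)) \<longlonglongrightarrow> 0"
    by (intro Lim_null_comparison[OF _ lim_const_over_n]) simp
  moreover have "(\<lambda>n. \<Sum>k<n. ?u n k) \<longlonglongrightarrow> integral {0..T} (\<lambda>s. m (y s) (y s))"
    using grid_limit_Riemann_sum[OF T y m z] by (simp add: sum_distrib_left)
  ultimately have "(\<lambda>n. \<Sum>k<n. ln (1 + ?u n k)) \<longlonglongrightarrow> integral {0..T} (\<lambda>s. m (y s) (y s))"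
    using tendsto_add by fastforce
  then have "(\<lambda>n. exp (\<Sum>k<n. ln (1 + ?u n k))) \<longlonglongrightarrow> exp (integral {0..T} (\<lambda>s. m (y s) (y s)))"
    by (rule tendsto_exp)
  moreover have "exp (\<Sum>k<n. ln (1 + ?u n k)) = (\<Prod>k<n. 1 + ?u n k)" for n
    using u0 by (simp add: exp_sum add_pos_nonneg)
  ultimately show ?thesis by simp
qed

definition grid_max :: "nat \<Rightarrow> (nat \<Rightarrow> real) \<Rightarrow> real" where
  "grid_max n z = Max ((\<lambda>k. \<bar>z k\<bar>) ` {..n})"

lemma grid_max_ge: "k \<le> n \<Longrightarrow> \<bar>z k\<bar> \<le> grid_max n z"
  by (auto simp: grid_max_def intro!: Max_ge)

lemma grid_max_le: "(\<And>k. k \<le> n \<Longrightarrow> \<bar>z k\<bar> \<le> B) \<Longrightarrow> grid_max n z \<le> B"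
  by (auto simp: grid_max_def)

lemma grid_limit_max:
  assumes T: "T > 0" and y: "continuous_on {0..T} y" and z: "grid_limit T y z"
  shows "(\<lambda>n. grid_max n (z n)) \<longlonglongrightarrow> (SUP s\<in>{0..T}. \<bar>y s\<bar>)"
proof -
  have "\<exists>t\<in>{0..T}. \<forall>s\<in>{0..T}. \<bar>y s\<bar> \<le> \<bar>y t\<bar>"
    by (rule continuous_attains_sup) (use T y in \<open>auto intro!: continuous_intros\<close>)
  then obtain t where t: "t \<in> {0..T}" and max: "\<And>s. s \<in> {0..T} \<Longrightarrow> \<bar>y s\<bar> \<le> \<bar>y t\<bar>" by blast
  have S: "(SUP s\<in>{0..T}. \<bar>y s\<bar>) = \<bar>y t\<bar>"
    by (rule cSup_eq_maximum) (use t max in auto)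
  show ?thesis unfolding S
  proof (rule LIMSEQ_I)
    fix r :: real assume r: "r > 0"
    have "uniformly_continuous_on {0..T} y"
      by (intro compact_uniformly_continuous y) simp
    then obtain \<eta> where \<eta>: "\<eta> > 0" and
      yunif: "\<And>s t. s \<in> {0..T} \<Longrightarrow> t \<in> {0..T} \<Longrightarrow> \<bar>t - s\<bar> < \<eta> \<Longrightarrow> \<bar>y t - y s\<bar> < r / 3"
      using r unfolding uniformly_continuous_on_def dist_real_def
      by (metis divide_pos_pos zero_less_numeral)
    have "\<forall>\<^sub>F n in sequentially. \<forall>k\<le>n. \<bar>z n k - y (T * real k / real n)\<bar> \<le> r / 3"
      using z[unfolded grid_limit_def, rule_format, of "r / 3"] r by simp
    with eventually_mesh_small[OF \<eta>, of T]
    have "\<forall>\<^sub>F n in sequentially. norm (grid_max n (z n) - \<bar>y t\<bar>) < r"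
    proof eventually_elim
      case (elim n)
      have upper: "grid_max n (z n) \<le> \<bar>y t\<bar> + r / 3"
      proof (rule grid_max_le)
        fix k assume k: "k \<le> n"
        have "\<bar>y (T * real k / real n)\<bar> \<le> \<bar>y t\<bar>"
          using T k elim by (intro max grid_point_in) auto
        moreover have "\<bar>z n k - y (T * real k / real n)\<bar> \<le> r / 3" using elim k by blast
        ultimately show "\<bar>z n k\<bar> \<le> \<bar>y t\<bar> + r / 3" by linarith
      qed
      \<comment> \<open>The last grid index not after the maximiser \<open>t\<close>. Oscillation of
        \<open>y\<close> within one cell and the error of the scheme cost \<open>r / 3\<close>
        each.\<close>
      define k where "k = nat \<lfloor>t * real n / T\<rfloor>"
      have nn: "real n > 0" using elim by simp
      have t0: "0 \<le> t * real n / T" using t T by simp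
      have k1: "real k \<le> t * real n / T" "t * real n / T < real k + 1"
        using t0 unfolding k_def by linarith+
      have "t * real n / T \<le> real n" using t T by (simp add: field_simps mult_right_mono)
      then have kn: "k \<le> n" using k1 by linarith
      have "T * real k / real n \<le> t" "t < T * real k / real n + T / real n"
        using k1 T nn by (simp_all add: field_simps)
      then have "\<bar>T * real k / real n - t\<bar> < \<eta>" using elim by linarith
      then have "\<bar>y (T * real k / real n) - y t\<bar> < r / 3"
        using T kn elim t by (intro yunif grid_point_in) auto
      moreover have "\<bar>z n k - y (T * real k / real n)\<bar> \<le> r / 3" using elim kn by blast
      moreover have "\<bar>z n k\<bar> \<le> grid_max n (z n)" using kn by (rule grid_max_ge)
      ultimately show ?case using upper r unfolding real_norm_def by linarith
    qed
    then show "\<exists>no. \<forall>n\<ge>no. norm (grid_max n (z n) - \<bar>y t\<bar>) < r"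
      by (simp add: eventually_sequentially)
  qed
qed

section \<open>Convergence of the scheme\<close>

context gradient_drift
begin

lemma l_lipschitz_on_ball:
  obtains K where "K \<ge> 0" "\<And>y z. \<bar>y\<bar> \<le> R \<Longrightarrow> \<bar>z\<bar> \<le> R \<Longrightarrow> \<bar>l y - l z\<bar> \<le> K * \<bar>y - z\<bar>"
proof -
  obtain K where K: "K \<ge> 0" "\<And>s. s \<in> {- R..R} \<Longrightarrow> \<bar>l' s\<bar> \<le> K"
    using continuous_on_abs_bound[OF continuous_on_subset[OF l'_cont subset_UNIV], of "- R" R] by blast
  have "\<bar>l y - l z\<bar> \<le> K * \<bar>y - z\<bar>" if "\<bar>y\<bar> \<le> R" "\<bar>z\<bar> \<le> R" for y z
  proof -
    have "norm (l y - l z) \<le> K * norm (y - z)"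
      by (rule field_differentiable_bound[of "{- R..R}" l l'])
         (use K that l_deriv in \<open>auto intro: has_field_derivative_at_within\<close>)
    then show ?thesis by simp
  qed
  then show thesis using that K(1) by blast
qed

text \<open>Monotonicity of \<open>avg l\<close> in the second argument gives the unconditional sign estimate, so that
  no a priori bound on the scheme is needed.\<close>

lemma implicit_step_error:
  assumes h: "h \<ge> 0" and K: "K \<ge> 0" and hK: "h * K \<le> 1"
    and lip: "\<And>y z. \<bar>y\<bar> \<le> R \<Longrightarrow> \<bar>z\<bar> \<le> R \<Longrightarrow> \<bar>l y - l z\<bar> \<le> K * \<bar>y - z\<bar>"
    and R: "\<bar>a\<bar> \<le> R" "\<bar>a'\<bar> \<le> R" "\<bar>b\<bar> \<le> R"
    and b: "b = a + h * avg l a b + v + \<rho>"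
  shows "\<bar>implicit_step h a' v - b\<bar> \<le> \<bar>a' - a\<bar> + \<bar>\<rho>\<bar>"
proof -
  define b' where "b' = implicit_step h a' v"
  have b': "b' = a' + h * avg l a' b' + v"
    unfolding b'_def by (rule implicit_step_eq[OF h])
  \<comment> \<open>The change of drift caused by moving the left end only. It is opposite in sign
    to \<open>a' - a\<close> and, because \<open>h * K \<le> 1\<close>, no larger, so adding it
    cannot enlarge the error.\<close>
  define D where "D = h * (avg l a' b - avg l a b)"
  have contr: "\<bar>a' - a + D\<bar> \<le> \<bar>a' - a\<bar>"
  proof -
    have "\<bar>avg l a' b - avg l a b\<bar> \<le> K * \<bar>a' - a\<bar>"
      by (rule avg_lipschitz_left[OF l_cont K lip]) (use R in auto)
    then have "\<bar>D\<bar> \<le> h * (K * \<bar>a' - a\<bar>)"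
      using h by (simp add: D_def abs_mult mult_left_mono)
    also have "\<dots> \<le> \<bar>a' - a\<bar>"
      using mult_right_mono[OF hK, of "\<bar>a' - a\<bar>"] by (simp add: mult.assoc)
    finally have le: "\<bar>D\<bar> \<le> \<bar>a' - a\<bar>" .
    show ?thesis
    proof (cases "a \<le> a'")
      case True
      then have "avg l a' b \<le> avg l a b" by (intro avg_antimono l_antimono l_cont) auto
      then have "D \<le> 0" using h by (simp add: D_def mult_nonneg_nonpos)
      then show ?thesis using le True by linarith
    next
      case False
      then have "avg l a b \<le> avg l a' b" by (intro avg_antimono l_antimono l_cont) auto
      then have "D \<ge> 0" using h by (simp add: D_def)
      then show ?thesis using le False by linarith
    qed
  qed
  \<comment> \<open>The remaining drift difference is opposite in sign to \<open>b' - b\<close>.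
    Dropping it in either case leaves \<open>\<bar>b' - b\<bar>\<close> at most
    \<open>\<bar>a' - a + D\<bar> + \<bar>\<rho>\<bar>\<close>, whatever the size of
    \<open>b'\<close>.\<close>
  have diff: "b' - b = a' - a + D + h * (avg l a' b' - avg l a' b) - \<rho>"
    using b b' by (simp add: D_def algebra_simps)
  show ?thesis
  proof (cases "b \<le> b'")
    case True
    then have "avg l a' b' \<le> avg l a' b" by (intro avg_antimono l_antimono l_cont) auto
    then have "h * (avg l a' b' - avg l a' b) \<le> 0" using h by (simp add: mult_nonneg_nonpos)
    then show ?thesis using diff contr True unfolding b'_def by linarith
  next
    case False
    then have "avg l a' b \<le> avg l a' b'" by (intro avg_antimono l_antimono l_cont) auto
    then have "h * (avg l a' b' - avg l a' b) \<ge> 0" using h by simp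
    then show ?thesis using diff contr False unfolding b'_def by linarith
  qed
qed

text \<open>The exact solution satisfies the scheme up to a residual in each step, namely the
  integral of the drift minus its discrete value. By \<open>implicit_step_error\<close> the
  residuals just add up: there is no Gronwall factor, and the error grows linearly in
  \<open>k\<close>.\<close>

lemma implicit_scheme_converges:
  assumes T: "T > 0" and X: "continuous_on {0..T} X"
    and eq: "\<And>t. t \<in> {0..T} \<Longrightarrow> X t = x + integral {0..t} (\<lambda>s. l (X s)) + w t"
    and X0: "X 0 = x"
  shows "grid_limit T X (\<lambda>n. iterate_noise (implicit_step (T / real n)) x
           (\<lambda>k. w (T * real (Suc k) / real n) - w (T * real k / real n)))"
  unfolding grid_limit_def
proof (intro allI impI)
  fix \<epsilon>' :: real assume "\<epsilon>' > 0"
  \<comment> \<open>Capping at 1 keeps the scheme in the ball of radius \<open>B + 1\<close>, where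
    \<open>K\<close> is a Lipschitz constant; the induction bootstraps this bound.\<close>
  define \<epsilon> where "\<epsilon> = min \<epsilon>' 1"
  have \<epsilon>: "\<epsilon> > 0" "\<epsilon> \<le> 1" "\<epsilon> \<le> \<epsilon>'" using \<open>\<epsilon>' > 0\<close> by (auto simp: \<epsilon>_def)
  obtain B where B: "\<And>s. s \<in> {0..T} \<Longrightarrow> \<bar>X s\<bar> \<le> B"
    using continuous_on_abs_bound[OF X] by blast
  obtain K where K: "K \<ge> 0"
    "\<And>y z. \<bar>y\<bar> \<le> B + 1 \<Longrightarrow> \<bar>z\<bar> \<le> B + 1 \<Longrightarrow> \<bar>l y - l z\<bar> \<le> K * \<bar>y - z\<bar>"
    using l_lipschitz_on_ball[of "B + 1"] by blast
  have lX: "continuous_on {0..T} (\<lambda>s. l (X s))"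
    by (rule continuous_on_compose2[OF l_cont X]) simp
  have K1: "1 / (K + 1) > 0" using K(1) by simp
  \<comment> \<open>A tolerance per unit of time: one step of length \<open>T / real n\<close>
    contributes \<open>\<epsilon> / real n\<close>.\<close>
  have "\<epsilon> / T > 0" using \<epsilon> T by simp
  from grid_limit_cells[OF T X continuous_on_avg[OF l_cont] grid_limit_self this]
    eventually_mesh_small[OF K1, of T]
  show "\<forall>\<^sub>F n in sequentially. \<forall>k\<le>n. \<bar>iterate_noise (implicit_step (T / real n)) x
      (\<lambda>k. w (T * real (Suc k) / real n) - w (T * real k / real n)) k - X (T * real k / real n)\<bar> \<le> \<epsilon>'"
  proof eventually_elim
    case (elim n)
    let ?t = "\<lambda>k. T * real k / real n"
    let ?z = "iterate_noise (implicit_step (T / real n)) x (\<lambda>k. w (?t (Suc k)) - w (?t k))"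
    have n: "n > 0" using elim by simp
    have hK: "T / real n * K \<le> 1"
    proof -
      have "T / real n < 1 / (K + 1)" using elim by blast
      then have "T / real n * (K + 1) < 1" using K(1) by (subst (asm) pos_less_divide_eq) auto
      moreover have "T / real n * K \<le> T / real n * (K + 1)" using T by (intro mult_left_mono) auto
      ultimately show ?thesis by linarith
    qed
    have "\<bar>?z k - X (?t k)\<bar> \<le> \<epsilon> * (real k / real n)" if "k \<le> n" for k
      using that
    proof (induction k)
      case 0
      then show ?case using X0 by simp
    next
      case (Suc k)
      have k: "k < n" using Suc.prems by simp
      have IH: "\<bar>?z k - X (?t k)\<bar> \<le> \<epsilon> * (real k / real n)" using Suc by simp
      also have "\<dots> \<le> \<epsilon> * 1" using k \<epsilon> by (intro mult_left_mono) auto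
      finally have z1: "\<bar>?z k - X (?t k)\<bar> \<le> 1" using \<epsilon> by linarith
      have pts: "?t k \<in> {0..T}" "?t (Suc k) \<in> {0..T}"
        using T k n by (intro grid_point_in; simp)+
      define I where "I = integral {?t k..?t (Suc k)} (\<lambda>s. l (X s))"
      have "integral {0..?t (Suc k)} (\<lambda>s. l (X s)) = integral {0..?t k} (\<lambda>s. l (X s)) + I"
        using integral_grid_sum[OF less_imp_le[OF T] lX n, of k]
          integral_grid_sum[OF less_imp_le[OF T] lX n, of "Suc k"] k
        unfolding I_def by simp
      then have XS: "X (?t (Suc k)) = X (?t k) + I + (w (?t (Suc k)) - w (?t k))"
        using eq[OF pts(1)] eq[OF pts(2)] by linarith
      let ?A = "avg l (X (?t k)) (X (?t (Suc k)))"
      have "\<bar>(?t (Suc k) - ?t k) * ?A - I\<bar> \<le> (?t (Suc k) - ?t k) * (\<epsilon> / T)"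
        unfolding I_def using elim k T grid_cell_subset[of T k n]
        by (intro integral_near_const continuous_on_subset[OF lX])
           (auto intro!: divide_right_mono mult_left_mono)
      then have \<rho>: "\<bar>I - T / real n * ?A\<bar> \<le> \<epsilon> / real n"
        using T by (simp only: grid_cell_width) (simp add: abs_minus_commute)
      have "\<bar>implicit_step (T / real n) (?z k) (w (?t (Suc k)) - w (?t k)) - X (?t (Suc k))\<bar>
          \<le> \<bar>?z k - X (?t k)\<bar> + \<bar>I - T / real n * ?A\<bar>"
      proof (rule implicit_step_error[where R = "B + 1" and K = K])
        show "\<bar>?z k\<bar> \<le> B + 1" using z1 B[OF pts(1)] by linarith
        show "X (?t (Suc k)) = X (?t k) + T / real n * ?A + (w (?t (Suc k)) - w (?t k)) + (I - T / real n * ?A)"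
          using XS by linarith
      qed (use T K hK B[OF pts(1)] B[OF pts(2)] in auto)
      also have "\<dots> \<le> \<epsilon> * (real k / real n) + \<epsilon> / real n" using IH \<rho> by linarith
      also have "\<dots> = \<epsilon> * (real (Suc k) / real n)" by (simp add: field_simps add_divide_distrib)
      finally show ?case by simp
    qed
    moreover have "\<epsilon> * (real k / real n) \<le> \<epsilon>'" if "k \<le> n" for k
    proof -
      have "\<epsilon> * (real k / real n) \<le> \<epsilon> * 1" using that n \<epsilon> by (intro mult_left_mono) auto
      then show ?thesis using \<epsilon> by linarith
    qed
    ultimately show ?case by (meson order.trans)
  qed
qed

end

section \<open>Change of measure for the discretised equation\<close>

lemma brownian_motionD:
  assumes "brownian_motion M W"
  shows "prob_space M"
    and "\<And>t. t \<ge> 0 \<Longrightarrow> W t \<in> borel_measurable M"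
    and "AE \<omega> in M. W 0 \<omega> = 0"
    and "\<And>\<omega>. \<omega> \<in> space M \<Longrightarrow> continuous_on {0..} (\<lambda>t. W t \<omega>)"
  using assms by (auto simp: brownian_motion_def)

text \<open>The law on the right does not mention \<open>M\<close> or \<open>W\<close>; it is the
  bridge between two Brownian motions on different spaces.\<close>

lemma brownian_increments_distr:
  fixes W :: "real \<Rightarrow> 'a \<Rightarrow> real"
  assumes W: "brownian_motion M W" and T: "T > 0" and n: "n > 0"
  shows "distr M (PiM {..<n} (\<lambda>_. borel))
      (\<lambda>\<omega>. \<lambda>k\<in>{..<n}. W (T * real (Suc k) / real n) \<omega> - W (T * real k / real n) \<omega>) =
    PiM {..<n} (\<lambda>_. density lborel (normal_density 0 (sqrt (T / real n))))"
proof -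
  interpret prob_space M using W by (rule brownian_motionD)
  note [measurable] = brownian_motionD(2)[OF W]
  let ?u = "\<lambda>k. T * real k / real n"
  let ?X = "\<lambda>k \<omega>. W (?u (Suc k)) \<omega> - W (?u k) \<omega>"
  have u0: "?u k \<ge> 0" for k using T by simp
  have X: "random_variable borel (?X k)" for k
    using T by (intro borel_measurable_diff brownian_motionD(2)[OF W]) auto
  have mono: "?u k < ?u (Suc k)" for k
    using grid_cell_width[of T k n] T n by (smt (verit) divide_pos_pos of_nat_0_less_iff)
  have "indep_vars (\<lambda>_. borel) ?X {..<n}"
    using W u0 mono unfolding brownian_motion_def
    by (elim conjE allE[of _ n] allE[of _ ?u]) (metis less_imp_le of_nat_0_le_iff)
  then have "distr M (PiM {..<n} (\<lambda>_. borel)) (\<lambda>\<omega>. \<lambda>k\<in>{..<n}. ?X k \<omega>) =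
      (\<Pi>\<^sub>M k\<in>{..<n}. distr M borel (?X k))"
    using n by (subst (asm) indep_vars_iff_distr_eq_PiM') (use X in auto)
  also have "\<dots> = PiM {..<n} (\<lambda>_. density lborel (normal_density 0 (sqrt (T / real n))))"
  proof (rule PiM_cong)
    fix k
    have "distributed M lborel (?X k) (normal_density 0 (sqrt (?u (Suc k) - ?u k)))"
      using W u0[of k] mono[of k] unfolding brownian_motion_def by blast
    then have "distr M lborel (?X k) = density lborel (normal_density 0 (sqrt (T / real n)))"
      by (simp only: distributed_def grid_cell_width)
    then show "distr M borel (?X k) = density lborel (normal_density 0 (sqrt (T / real n)))"
      by (metis (no_types, lifting) distr_cong sets_lborel)
  qed simp
  finally show ?thesis .
qed

lemma iterate_noise_scale:
  "iterate_noise (\<lambda>a v. g a (\<sigma> * v)) x v k = iterate_noise g x (\<lambda>k. \<sigma> * v k) k"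
  by (induction k) auto

text \<open>The increments telescope. The term \<open>w 0\<close> stays, since a Brownian motion
  here vanishes at time 0 only almost surely.\<close>

lemma iterate_noise_free:
  "iterate_noise (\<lambda>a v. a + \<sigma> * v) x (\<lambda>k. w (Suc k) - w k) k = x + \<sigma> * (w k - w 0)"
  by (induction k) (auto simp: algebra_simps)

lemma nn_integral_brownian_chain:
  fixes W :: "real \<Rightarrow> 'a \<Rightarrow> real" and F :: "(nat \<Rightarrow> real) \<Rightarrow> ennreal"
  assumes W: "brownian_motion M W" and T: "T > 0" and n: "n > 0"
    and F: "F \<in> borel_measurable (PiM {..n} (\<lambda>_. borel))"
    and g: "(\<lambda>p. g (fst p) (snd p)) \<in> borel_measurable (borel \<Otimes>\<^sub>M borel)"
  shows "(\<integral>\<^sup>+\<omega>. F (restrict (iterate_noise g x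
            (\<lambda>k. W (T * real (Suc k) / real n) \<omega> - W (T * real k / real n) \<omega>)) {..n}) \<partial>M) =
    (\<integral>\<^sup>+v. F (restrict (iterate_noise g x v) {..n})
        \<partial>PiM {..<n} (\<lambda>_. density lborel (normal_density 0 (sqrt (T / real n)))))"
proof -
  let ?V = "\<lambda>\<omega> k. W (T * real (Suc k) / real n) \<omega> - W (T * real k / real n) \<omega>"
  have m: "(\<lambda>v. F (restrict (iterate_noise g x v) {..n})) \<in> borel_measurable (PiM {..<n} (\<lambda>_. borel))"
  proof (rule measurable_compose[OF _ F], rule measurable_restrict)
    show "(\<lambda>v. iterate_noise g x v k) \<in> borel_measurable (PiM {..<n} (\<lambda>_. borel))" if "k \<in> {..n}" for k
      by (rule measurable_iterate_noise[OF g]) (use that in auto)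
  qed
  have V: "(\<lambda>\<omega>. restrict (?V \<omega>) {..<n}) \<in> measurable M (PiM {..<n} (\<lambda>_. borel))"
    using T by (intro measurable_restrict borel_measurable_diff brownian_motionD(2)[OF W]) auto
  have "restrict (iterate_noise g x (?V \<omega>)) {..n} =
      restrict (iterate_noise g x (restrict (?V \<omega>) {..<n})) {..n}" for \<omega>
    by (rule restrict_ext, rule iterate_noise_cong) auto
  then show ?thesis
    unfolding brownian_increments_distr[OF W T n, symmetric]
    using m by (subst nn_integral_distr[OF V]) simp_all
qed

context gradient_drift
begin

definition grid_density :: "real \<Rightarrow> real \<Rightarrow> nat \<Rightarrow> (nat \<Rightarrow> real) \<Rightarrow> real" where
  "grid_density \<sigma> T n z = (\<Prod>k<n. step_density (T / real n) \<sigma> (z k) (z (Suc k)))"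

lemma grid_density_nonneg: "T \<ge> 0 \<Longrightarrow> grid_density \<sigma> T n z \<ge> 0"
  unfolding grid_density_def by (intro prod_nonneg ballI step_density_nonneg) simp

text \<open>The increments of \<open>L\<close> telescope. The Jacobian factors are written with
  \<open>- wavg l'\<close>, which is nonnegative, to fit \<open>grid_limit_product\<close>.\<close>

lemma grid_density_eq:
  "grid_density \<sigma> T n z =
     exp ((L (z n) - L (z 0)) / \<sigma>\<^sup>2 - T / real n * (\<Sum>k<n. (avg l (z k) (z (Suc k)))\<^sup>2) / (2 * \<sigma>\<^sup>2)) *
     (\<Prod>k<n. 1 + T / real n * - wavg l' (z k) (z (Suc k)))"
proof -
  have "(\<Sum>k<n. (L (z (Suc k)) - L (z k)) / \<sigma>\<^sup>2 - T / real n * (avg l (z k) (z (Suc k)))\<^sup>2 / (2 * \<sigma>\<^sup>2)) =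
      (L (z n) - L (z 0)) / \<sigma>\<^sup>2 - T / real n * (\<Sum>k<n. (avg l (z k) (z (Suc k)))\<^sup>2) / (2 * \<sigma>\<^sup>2)"
  proof -
    have "(\<Sum>k<n. (L (z (Suc k)) - L (z k)) / \<sigma>\<^sup>2) = (L (z n) - L (z 0)) / \<sigma>\<^sup>2"
      by (simp only: sum_lessThan_telescope[of "\<lambda>k. L (z k)"] flip: sum_divide_distrib)
    then show ?thesis
      by (simp add: sum_subtractf[of "\<lambda>k. (L (z (Suc k)) - L (z k)) / \<sigma>\<^sup>2"] sum_distrib_left
          flip: sum_divide_distrib)
  qed
  then show ?thesis
    by (simp add: grid_density_def step_density_def prod.distrib flip: exp_sum)
qed

lemma measurable_grid_comp:
  fixes c :: "real \<Rightarrow> real \<Rightarrow> real"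
  assumes c: "(\<lambda>p. c (fst p) (snd p)) \<in> borel_measurable (borel \<Otimes>\<^sub>M borel)" and "Suc k \<le> n"
  shows "(\<lambda>z. c (z k) (z (Suc k))) \<in> borel_measurable (PiM {..n} (\<lambda>_. borel))"
proof -
  have "(\<lambda>z. (z k, z (Suc k))) \<in> measurable (PiM {..n} (\<lambda>_. borel)) (borel \<Otimes>\<^sub>M borel)"
    using assms by (intro measurable_Pair measurable_component_singleton) auto
  from measurable_compose[OF this c] show ?thesis by simp
qed

text \<open>Both expectations are carried over to the same product of Gaussian laws, where the chain
  identity acts. The assumption \<open>local\<close> reconciles total sequences with the extensional
  ones that make up the space of \<open>PiM\<close>.\<close>

lemma discrete_change_of_measure:
  fixes W :: "real \<Rightarrow> 'a \<Rightarrow> real" and W' :: "real \<Rightarrow> 'b \<Rightarrow> real" and f :: "(nat \<Rightarrow> real) \<Rightarrow> real"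
  assumes W: "brownian_motion M W" and W': "brownian_motion M' W'"
    and T: "T > 0" and \<sigma>: "\<sigma> > 0" and n: "n > 0"
    and f: "f \<in> borel_measurable (PiM {..n} (\<lambda>_. borel))" and f0: "\<And>z. f z \<ge> 0"
    and local: "\<And>z. f (restrict z {..n}) = f z"
  shows "(\<integral>\<^sup>+\<omega>. ennreal (f (iterate_noise (implicit_step (T / real n)) x
            (\<lambda>k. \<sigma> * W (T * real (Suc k) / real n) \<omega> - \<sigma> * W (T * real k / real n) \<omega>))) \<partial>M) =
         (\<integral>\<^sup>+\<omega>. ennreal (f (\<lambda>k. x + \<sigma> * (W' (T * real k / real n) \<omega> - W' 0 \<omega>)) *
            grid_density \<sigma> T n (\<lambda>k. x + \<sigma> * (W' (T * real k / real n) \<omega> - W' 0 \<omega>))) \<partial>M')"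
proof -
  define h where "h = T / real n"
  have h: "h > 0" using T n by (simp add: h_def)
  let ?N = "density lborel (normal_density 0 (sqrt h))"
  let ?g1 = "\<lambda>a v. implicit_step h a (\<sigma> * v)" and ?g2 = "\<lambda>a v. a + \<sigma> * v"
  let ?V = "\<lambda>W \<omega> k. W (T * real (Suc k) / real n) \<omega> - W (T * real k / real n) \<omega> :: real"
  let ?d = "\<lambda>a b. ennreal (step_density h \<sigma> a b)"
  have g1: "(\<lambda>p. ?g1 (fst p) (snd p)) \<in> borel_measurable (borel \<Otimes>\<^sub>M borel)"
  proof -
    have "(\<lambda>p. (fst p, \<sigma> * snd p)) \<in> measurable (borel \<Otimes>\<^sub>M borel) (borel \<Otimes>\<^sub>M borel)"
      by measurable
    from measurable_compose[OF this measurable_implicit_step[of h]] show ?thesis using h by simp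
  qed
  have g2: "(\<lambda>p. ?g2 (fst p) (snd p)) \<in> borel_measurable (borel \<Otimes>\<^sub>M borel)" by measurable
  have d: "(\<lambda>p. ?d (fst p) (snd p)) \<in> borel_measurable (borel \<Otimes>\<^sub>M borel)"
    using measurable_step_density[of h \<sigma>] by measurable
  have dens: "(\<Prod>k<n. ?d (z k) (z (Suc k))) = ennreal (grid_density \<sigma> T n z)" for z
    using h unfolding grid_density_def h_def[symmetric]
    by (intro prod_ennreal step_density_nonneg) simp
  have dens_local: "grid_density \<sigma> T n (restrict z {..n}) = grid_density \<sigma> T n z" for z
    by (simp add: grid_density_def)
  have dens_meas: "grid_density \<sigma> T n \<in> borel_measurable (PiM {..n} (\<lambda>_. borel))"
    unfolding grid_density_def
    by (intro borel_measurable_prod measurable_grid_comp measurable_step_density) auto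
  have N: "prob_space ?N" using h by (intro prob_space_normal_density) simp
  have "(\<integral>\<^sup>+\<omega>. ennreal (f (iterate_noise (implicit_step h) x
            (\<lambda>k. \<sigma> * W (T * real (Suc k) / real n) \<omega> - \<sigma> * W (T * real k / real n) \<omega>))) \<partial>M) =
        (\<integral>\<^sup>+\<omega>. ennreal (f (restrict (iterate_noise ?g1 x (?V W \<omega>)) {..n})) \<partial>M)"
    by (simp add: local iterate_noise_scale[abs_def] right_diff_distrib)
  also have "\<dots> = (\<integral>\<^sup>+v. ennreal (f (restrict (iterate_noise ?g1 x v) {..n})) \<partial>PiM {..<n} (\<lambda>_. ?N))"
    unfolding h_def[symmetric]
    using nn_integral_brownian_chain[OF W T n _ g1, of "\<lambda>z. ennreal (f z)" x] f by (simp add: h_def)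
  also have "\<dots> = (\<integral>\<^sup>+v. (\<Prod>k<n. ?d (iterate_noise ?g2 x v k) (iterate_noise ?g2 x v (Suc k))) *
        ennreal (f (restrict (iterate_noise ?g2 x v) {..n})) \<partial>PiM {..<n} (\<lambda>_. ?N))"
    by (rule chain_change_of_measure[OF N _ g1 g2 d])
       (use implicit_step_change_of_measure[OF h \<sigma>] f in auto)
  also have "\<dots> = (\<integral>\<^sup>+v. ennreal (f (restrict (iterate_noise ?g2 x v) {..n}) *
        grid_density \<sigma> T n (restrict (iterate_noise ?g2 x v) {..n})) \<partial>PiM {..<n} (\<lambda>_. ?N))"
    unfolding dens dens_local using f0 T grid_density_nonneg
    by (simp add: ennreal_mult mult.commute)
  also have "\<dots> = (\<integral>\<^sup>+\<omega>. ennreal (f (restrict (iterate_noise ?g2 x (?V W' \<omega>)) {..n}) *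
        grid_density \<sigma> T n (restrict (iterate_noise ?g2 x (?V W' \<omega>)) {..n})) \<partial>M')"
    using nn_integral_brownian_chain[OF W' T n _ g2, of "\<lambda>z. ennreal (f z * grid_density \<sigma> T n z)" x]
      f dens_meas by (simp add: h_def)
  also have "\<dots> = (\<integral>\<^sup>+\<omega>. ennreal (f (\<lambda>k. x + \<sigma> * (W' (T * real k / real n) \<omega> - W' 0 \<omega>)) *
            grid_density \<sigma> T n (\<lambda>k. x + \<sigma> * (W' (T * real k / real n) \<omega> - W' 0 \<omega>))) \<partial>M')"
  proof -
    have "iterate_noise ?g2 x (?V W' \<omega>) = (\<lambda>k. x + \<sigma> * (W' (T * real k / real n) \<omega> - W' 0 \<omega>))" for \<omega>
      using iterate_noise_free[of \<sigma> x "\<lambda>k. W' (T * real k / real n) \<omega>"] by auto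
    then show ?thesis by (simp only: local dens_local)
  qed
  finally show ?thesis by (simp only: h_def)
qed

end

section \<open>Limits of the truncated functionals and bounds uniform in the mesh\<close>

lemma grid_limit_endpoints:
  assumes "grid_limit T y z"
  shows "(\<lambda>n. z n 0) \<longlonglongrightarrow> y 0" and "(\<lambda>n. z n n) \<longlonglongrightarrow> y T"
proof -
  have ev: "\<forall>\<^sub>F n in sequentially. \<forall>k\<le>n. \<bar>z n k - y (T * real k / real n)\<bar> < \<epsilon>" if "\<epsilon> > 0" for \<epsilon>
  proof -
    have "\<epsilon> / 2 > 0" using that by simp
    with assms have "\<forall>\<^sub>F n in sequentially. \<forall>k\<le>n. \<bar>z n k - y (T * real k / real n)\<bar> \<le> \<epsilon> / 2"
      unfolding grid_limit_def by blast
    then show ?thesis by eventually_elim (use that in fastforce)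
  qed
  show "(\<lambda>n. z n 0) \<longlonglongrightarrow> y 0"
  proof (rule tendstoI)
    fix \<epsilon> :: real assume "\<epsilon> > 0"
    from ev[OF this] show "\<forall>\<^sub>F n in sequentially. dist (z n 0) (y 0) < \<epsilon>"
      by eventually_elim (auto simp: dist_real_def dest: spec[of _ 0])
  qed
  show "(\<lambda>n. z n n) \<longlonglongrightarrow> y T"
  proof (rule tendstoI)
    fix \<epsilon> :: real assume "\<epsilon> > 0"
    from ev[OF this] eventually_gt_at_top[of 0] show "\<forall>\<^sub>F n in sequentially. dist (z n n) (y T) < \<epsilon>"
      by eventually_elim (auto simp: dist_real_def)
  qed
qed

text \<open>Equal to 1 up to \<open>R\<close> and to 0 from \<open>R + 1\<close> on. Unlike an
  indicator it is continuous, so pathwise limits pass through it at every path, and it increases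
  with \<open>R\<close>, as monotone convergence requires.\<close>

definition cutoff :: "real \<Rightarrow> real \<Rightarrow> real" where
  "cutoff R m = max 0 (min 1 (R + 1 - m))"

lemma cutoff_bounds: "0 \<le> cutoff R m" "cutoff R m \<le> 1"
  by (auto simp: cutoff_def)

lemma cutoff_eq_0: "R + 1 \<le> m \<Longrightarrow> cutoff R m = 0"
  by (auto simp: cutoff_def)

lemma continuous_on_bounded_square:
  fixes c :: "real \<Rightarrow> real \<Rightarrow> real"
  assumes "continuous_on UNIV (\<lambda>p. c (fst p) (snd p))"
  obtains B where "B \<ge> 0" "\<And>a b. \<bar>a\<bar> \<le> R \<Longrightarrow> \<bar>b\<bar> \<le> R \<Longrightarrow> \<bar>c a b\<bar> \<le> B"
proof -
  have "bounded ((\<lambda>p. c (fst p) (snd p)) ` ({- R..R} \<times> {- R..R}))"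
    by (intro compact_imp_bounded compact_continuous_image continuous_on_subset[OF assms] compact_Times) auto
  then obtain B where B: "\<And>q. q \<in> (\<lambda>p. c (fst p) (snd p)) ` ({- R..R} \<times> {- R..R}) \<Longrightarrow> norm q \<le> B"
    unfolding bounded_iff by blast
  have "\<bar>c a b\<bar> \<le> max B 0" if "\<bar>a\<bar> \<le> R" "\<bar>b\<bar> \<le> R" for a b
  proof -
    have "c a b \<in> (\<lambda>p. c (fst p) (snd p)) ` ({- R..R} \<times> {- R..R})"
      by (rule image_eqI[of _ _ "(a, b)"]) (use that in auto)
    from B[OF this] show ?thesis by simp
  qed
  then show thesis using that[of "max B 0"] by simp
qed

context gradient_drift
begin

definition grid_functional :: "real \<Rightarrow> real \<Rightarrow> real \<Rightarrow> real \<Rightarrow> nat \<Rightarrow> (nat \<Rightarrow> real) \<Rightarrow> real" where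
  "grid_functional \<sigma> a T R n z = cutoff R (grid_max n z) *
     exp (a * (T / real n * (\<Sum>k<n. (avg l (z k) (z (Suc k)))\<^sup>2 / \<sigma>\<^sup>2)))"

lemma grid_functional_nonneg: "grid_functional \<sigma> a T R n z \<ge> 0"
  by (simp add: grid_functional_def cutoff_bounds)

lemma grid_functional_local: "grid_functional \<sigma> a T R n (restrict z {..n}) = grid_functional \<sigma> a T R n z"
  by (simp add: grid_functional_def grid_max_def)

lemma measurable_grid_functional:
  "grid_functional \<sigma> a T R n \<in> borel_measurable (PiM {..n} (\<lambda>_. borel))"
proof -
  have 1: "(\<lambda>z. (avg l (z k) (z (Suc k)))) \<in> borel_measurable (PiM {..n} (\<lambda>_. borel))" if "k \<in> {..<n}" for k
    using that by (intro measurable_grid_comp measurable_avg_l) auto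
  have "(\<lambda>z. z k) \<in> borel_measurable (PiM {..n} (\<lambda>_. borel))" if "k \<in> {..n}" for k
    by (rule measurable_component_singleton[OF that])
  then have 2: "grid_max n \<in> borel_measurable (PiM {..n} (\<lambda>_. borel))"
    unfolding grid_max_def by (intro borel_measurable_Max borel_measurable_abs) auto
  note [measurable] = 2
  have 3: "(\<lambda>z. \<Sum>k<n. (avg l (z k) (z (Suc k)))\<^sup>2 / \<sigma>\<^sup>2) \<in> borel_measurable (PiM {..n} (\<lambda>_. borel))"
    by (intro borel_measurable_sum borel_measurable_divide borel_measurable_power 1) auto
  note [measurable] = 3
  show ?thesis unfolding grid_functional_def cutoff_def by measurable
qed

lemma continuous_avg_sq: "continuous_on UNIV (\<lambda>p. (avg l (fst p) (snd p))\<^sup>2 / \<sigma>\<^sup>2 :: real)"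
  \<comment> \<open>For \<open>\<sigma> = 0\<close> the quotient is constantly 0 by the convention
    on division.\<close>
  by (cases "\<sigma> = 0") (auto intro!: continuous_intros continuous_on_avg l_cont)

lemma grid_functional_limit:
  assumes T: "T > 0" and y: "continuous_on {0..T} y" and z: "grid_limit T y z"
  shows "(\<lambda>n. grid_functional \<sigma> a T R n (z n)) \<longlonglongrightarrow>
     cutoff R (SUP s\<in>{0..T}. \<bar>y s\<bar>) * exp (a * integral {0..T} (\<lambda>s. (l (y s))\<^sup>2 / \<sigma>\<^sup>2))"
proof -
  have "(\<lambda>n. T / real n * (\<Sum>k<n. (avg l (z n k) (z n (Suc k)))\<^sup>2 / \<sigma>\<^sup>2)) \<longlonglongrightarrow>
      integral {0..T} (\<lambda>s. (l (y s))\<^sup>2 / \<sigma>\<^sup>2)"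
    using grid_limit_Riemann_sum[OF T y continuous_avg_sq z] by simp
  then show ?thesis
    unfolding grid_functional_def cutoff_def
    by (intro tendsto_intros grid_limit_max[OF T y z])
qed

lemma grid_density_limit:
  assumes T: "T > 0" and y: "continuous_on {0..T} y" and z: "grid_limit T y z"
  shows "(\<lambda>n. grid_density \<sigma> T n (z n)) \<longlonglongrightarrow>
     exp ((L (y T) - L (y 0)) / \<sigma>\<^sup>2 - integral {0..T} (\<lambda>s. (l (y s))\<^sup>2) / (2 * \<sigma>\<^sup>2)) *
     exp (integral {0..T} (\<lambda>s. - (l' (y s) / 2)))"
proof -
  have c1: "continuous_on UNIV (\<lambda>p. (avg l (fst p) (snd p))\<^sup>2)"
    by (intro continuous_intros continuous_on_avg l_cont)
  have 1: "(\<lambda>n. T / real n * (\<Sum>k<n. (avg l (z n k) (z n (Suc k)))\<^sup>2)) \<longlonglongrightarrow>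
      integral {0..T} (\<lambda>s. (l (y s))\<^sup>2)"
    using grid_limit_Riemann_sum[OF T y c1 z] by simp
  have c2: "continuous_on UNIV (\<lambda>p. - wavg l' (fst p) (snd p))"
    by (intro continuous_intros continuous_on_wavg l'_cont)
  have 2: "(\<lambda>n. \<Prod>k<n. 1 + T / real n * - wavg l' (z n k) (z n (Suc k))) \<longlonglongrightarrow>
      exp (integral {0..T} (\<lambda>s. - (l' (y s) / 2)))"
    using grid_limit_product[OF T y c2 _ z] wavg_nonpos[OF l'_nonpos l'_cont] by simp
  have L: "isCont L u" for u by (rule DERIV_isCont[OF L_deriv])
  show ?thesis
    \<comment> \<open>Multiplication by a constant inverse replaces the quotients, whose limit rule
      would ask for nonzero denominators.\<close>
    unfolding grid_density_eq divide_inverse[of _ "\<sigma>\<^sup>2"] divide_inverse[of _ "2 * \<sigma>\<^sup>2"]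
    by (intro tendsto_intros isCont_tendsto_compose[OF L] grid_limit_endpoints[OF z] 1 2)
qed

text \<open>Either the cutoff vanishes, or all grid points lie in the ball of radius
  \<open>R + 1\<close>, where the integrand is bounded. The bound does not depend on the mesh and
  serves as the dominating constant.\<close>

lemma grid_functional_bounded:
  assumes T: "T > 0" and a: "a \<ge> 0"
  obtains C where "\<And>n z. n > 0 \<Longrightarrow> grid_functional \<sigma> a T R n z \<le> C"
proof -
  obtain B where B: "B \<ge> 0" "\<And>u v. \<bar>u\<bar> \<le> R + 1 \<Longrightarrow> \<bar>v\<bar> \<le> R + 1 \<Longrightarrow> \<bar>(avg l u v)\<^sup>2 / \<sigma>\<^sup>2\<bar> \<le> B"
    using continuous_on_bounded_square[of "\<lambda>u v. (avg l u v)\<^sup>2 / \<sigma>\<^sup>2" "R + 1", OF continuous_avg_sq]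
    by blast
  have "grid_functional \<sigma> a T R n z \<le> exp (a * (T * B))" if n: "n > 0" for n z
  proof (cases "grid_max n z \<le> R + 1")
    case True
    then have in_ball: "\<bar>z k\<bar> \<le> R + 1" if "k \<le> n" for k
      using grid_max_ge[OF that, of z] by linarith
    have "(\<Sum>k<n. (avg l (z k) (z (Suc k)))\<^sup>2 / \<sigma>\<^sup>2) \<le> (\<Sum>k<n. B)"
    proof (rule sum_mono)
      fix k assume "k \<in> {..<n}"
      then show "(avg l (z k) (z (Suc k)))\<^sup>2 / \<sigma>\<^sup>2 \<le> B"
        using B(2)[of "z k" "z (Suc k)"] in_ball by fastforce
    qed
    then have "T / real n * (\<Sum>k<n. (avg l (z k) (z (Suc k)))\<^sup>2 / \<sigma>\<^sup>2) \<le> T / real n * (real n * B)"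
      using T by (intro mult_left_mono) auto
    also have "T / real n * (real n * B) = T * B" using n by simp
    finally have "exp (a * (T / real n * (\<Sum>k<n. (avg l (z k) (z (Suc k)))\<^sup>2 / \<sigma>\<^sup>2))) \<le> exp (a * (T * B))"
      using mult_left_mono[OF _ a] by (subst exp_le_cancel_iff)
    from mult_mono[OF cutoff_bounds(2) this] show ?thesis
      unfolding grid_functional_def by simp
  next
    case False
    then show ?thesis by (simp add: grid_functional_def cutoff_eq_0)
  qed
  then show thesis using that by blast
qed

text \<open>On the ball of radius \<open>R + 1\<close> the density itself is bounded, although it
  need not be without the cutoff.\<close>

lemma weighted_grid_functional_bounded:
  assumes T: "T > 0" and a: "a \<ge> 0"
  obtains C where
    "\<And>n z. n > 0 \<Longrightarrow> z 0 = x \<Longrightarrow> grid_functional \<sigma> a T R n z * grid_density \<sigma> T n z \<le> C"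
proof -
  obtain C where C: "\<And>n z. n > 0 \<Longrightarrow> grid_functional \<sigma> a T R n z \<le> C"
    using grid_functional_bounded[OF T a] by blast
  obtain B where B: "B \<ge> 0" "\<And>u v. \<bar>u\<bar> \<le> R + 1 \<Longrightarrow> \<bar>v\<bar> \<le> R + 1 \<Longrightarrow> \<bar>wavg l' u v\<bar> \<le> B"
    using continuous_on_bounded_square[of "wavg l'" "R + 1", OF continuous_on_wavg[OF l'_cont]] by blast
  obtain A where A: "A \<ge> 0" "\<And>u. u \<in> {- (R + 1)..R + 1} \<Longrightarrow> \<bar>L u\<bar> \<le> A"
    using continuous_on_abs_bound[OF continuous_on_subset[OF L_cont subset_UNIV]] by blast
  \<comment> \<open>The quadratic term of the exponent is dropped for its sign,
    \<open>L (z n)\<close> is at most \<open>A\<close>, and each of the \<open>n\<close> Jacobian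
    factors is at most \<open>exp (T / real n * B)\<close>.\<close>
  define D where "D = exp ((A - L x) / \<sigma>\<^sup>2) * exp (T * B)"
  have "grid_functional \<sigma> a T R n z * grid_density \<sigma> T n z \<le> C * D"
    if n: "n > 0" and z0: "z 0 = x" for n z
  proof (cases "grid_max n z \<le> R + 1")
    case True
    then have in_ball: "\<bar>z k\<bar> \<le> R + 1" if "k \<le> n" for k
      using grid_max_ge[OF that, of z] by linarith
    have e: "(L (z n) - L (z 0)) / \<sigma>\<^sup>2 - T / real n * (\<Sum>k<n. (avg l (z k) (z (Suc k)))\<^sup>2) / (2 * \<sigma>\<^sup>2)
        \<le> (A - L x) / \<sigma>\<^sup>2"
    proof -
      have "L (z n) \<le> A" using A(2)[of "z n"] in_ball[of n] by (auto simp: abs_le_iff)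
      then have "(L (z n) - L (z 0)) / \<sigma>\<^sup>2 \<le> (A - L x) / \<sigma>\<^sup>2"
        unfolding z0 by (intro divide_right_mono) auto
      moreover have "T / real n * (\<Sum>k<n. (avg l (z k) (z (Suc k)))\<^sup>2) / (2 * \<sigma>\<^sup>2) \<ge> 0"
        using T by (intro divide_nonneg_nonneg mult_nonneg_nonneg sum_nonneg) auto
      ultimately show ?thesis by linarith
    qed
    let ?m = "\<lambda>k. 1 + T / real n * - wavg l' (z k) (z (Suc k))"
    have m: "0 \<le> ?m k \<and> ?m k \<le> exp (T / real n * B)" if k: "k < n" for k
    proof -
      have "0 \<le> - wavg l' (z k) (z (Suc k))"
        using wavg_nonpos[OF l'_nonpos l'_cont] by simp
      then have "0 \<le> T / real n * - wavg l' (z k) (z (Suc k))"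
        using T by (intro mult_nonneg_nonneg) auto
      moreover have "- wavg l' (z k) (z (Suc k)) \<le> B"
        using B(2)[of "z k" "z (Suc k)"] in_ball[of k] in_ball[of "Suc k"] k by auto
      then have "T / real n * - wavg l' (z k) (z (Suc k)) \<le> T / real n * B"
        using T by (intro mult_left_mono) auto
      moreover have "1 + T / real n * B \<le> exp (T / real n * B)"
        by (rule exp_ge_add_one_self)
      ultimately show ?thesis by linarith
    qed
    have "(\<Prod>k<n. ?m k) \<le> (\<Prod>k<n. exp (T / real n * B))"
      by (rule prod_mono) (use m in simp)
    also have "\<dots> = exp (T * B)"
      using n by (simp flip: exp_of_nat_mult)
    finally have "(\<Prod>k<n. ?m k) \<le> exp (T * B)" .
    moreover have "(\<Prod>k<n. ?m k) \<ge> 0"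
      by (rule prod_nonneg) (use m in blast)
    ultimately have "grid_density \<sigma> T n z \<le> D"
      unfolding grid_density_eq D_def using e by (intro mult_mono) auto
    then show ?thesis
      using C[OF n, of z] grid_functional_nonneg grid_density_nonneg[of T] T
      by (intro mult_mono) (auto intro: order.trans[OF grid_functional_nonneg])
  next
    case False
    have "0 \<le> C" using C[OF n] grid_functional_nonneg order.trans by blast
    then show ?thesis using False by (simp add: grid_functional_def cutoff_eq_0 D_def)
  qed
  then show thesis using that by blast
qed

end

section \<open>Passage to the limit\<close>

text \<open>Riemann sums involve finitely many coordinates, and their pathwise limit inherits
  measurability. The result serves for processes on a probability space and for the coordinates on
  \<open>path_space\<close> alike.\<close>

lemma measurable_path_integral:
  fixes Y :: "real \<Rightarrow> 'a \<Rightarrow> real" and \<phi> :: "real \<Rightarrow> real"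
  assumes T: "T > 0" and Y: "\<And>t. t \<in> {0..T} \<Longrightarrow> Y t \<in> borel_measurable M"
    and path: "\<And>\<omega>. \<omega> \<in> space M \<Longrightarrow> continuous_on {0..T} (\<lambda>t. Y t \<omega>)"
    and \<phi>: "continuous_on UNIV \<phi>"
  shows "(\<lambda>\<omega>. integral {0..T} (\<lambda>s. \<phi> (Y s \<omega>))) \<in> borel_measurable M"
proof (rule borel_measurable_LIMSEQ_real)
  have c: "continuous_on UNIV (\<lambda>p. \<phi> (fst p))"
    by (rule continuous_on_compose2[OF \<phi>]) (auto intro!: continuous_intros)
  show "(\<lambda>n. T / real n * (\<Sum>k<n. \<phi> (Y (T * real k / real n) \<omega>)))
      \<longlonglongrightarrow> integral {0..T} (\<lambda>s. \<phi> (Y s \<omega>))" if "\<omega> \<in> space M" for \<omega>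
    using grid_limit_Riemann_sum[OF T path[OF that] c grid_limit_self] .
  have [measurable]: "\<phi> \<in> borel_measurable borel" by (rule borel_measurable_continuous_onI[OF \<phi>])
  show "(\<lambda>\<omega>. T / real n * (\<Sum>k<n. \<phi> (Y (T * real k / real n) \<omega>))) \<in> borel_measurable M" for n
  proof -
    have "(\<lambda>\<omega>. \<phi> (Y (T * real k / real n) \<omega>)) \<in> borel_measurable M" if "k \<in> {..<n}" for k
      by (rule measurable_compose[OF Y]) (use that T in \<open>auto intro!: grid_point_in simp del: atLeastAtMost_iff\<close>)
    then show ?thesis by (intro borel_measurable_times borel_measurable_sum) auto
  qed
qed

lemma measurable_path_sup:
  fixes Y :: "real \<Rightarrow> 'a \<Rightarrow> real"
  assumes T: "T > 0" and Y: "\<And>t. t \<in> {0..T} \<Longrightarrow> Y t \<in> borel_measurable M"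
    and path: "\<And>\<omega>. \<omega> \<in> space M \<Longrightarrow> continuous_on {0..T} (\<lambda>t. Y t \<omega>)"
  shows "(\<lambda>\<omega>. SUP s\<in>{0..T}. \<bar>Y s \<omega>\<bar>) \<in> borel_measurable M"
proof (rule borel_measurable_LIMSEQ_real)
  show "(\<lambda>n. grid_max n (\<lambda>k. Y (T * real k / real n) \<omega>)) \<longlonglongrightarrow> (SUP s\<in>{0..T}. \<bar>Y s \<omega>\<bar>)"
    if "\<omega> \<in> space M" for \<omega>
    using grid_limit_max[OF T path[OF that] grid_limit_self] .
  show "(\<lambda>\<omega>. grid_max n (\<lambda>k. Y (T * real k / real n) \<omega>)) \<in> borel_measurable M" for n
    unfolding grid_max_def
  proof (intro borel_measurable_Max borel_measurable_abs)
    fix k assume "k \<in> {..n}"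
    then have "T * real k / real n \<in> {0..T}"
      \<comment> \<open>For \<open>n = 0\<close> the only index is 0, and the time is 0 by the
        convention on division.\<close>
      using T grid_point_in[of T n k] by (cases "n = 0") auto
    then show "Y (T * real k / real n) \<in> borel_measurable M" by (rule Y)
  qed simp
qed

lemma measurable_cutoff [measurable]: "cutoff R \<in> borel_measurable borel"
  unfolding cutoff_def by measurable

text \<open>Monotone convergence allows an infinite limit, which is why the final identity holds in
  all of \<open>[0, \<infinity>]\<close>.\<close>

lemma nn_integral_cutoff_limit:
  assumes S: "S \<in> borel_measurable M" and G: "G \<in> borel_measurable M" and G0: "\<And>\<omega>. G \<omega> \<ge> 0"
  shows "(\<lambda>R. \<integral>\<^sup>+\<omega>. ennreal (cutoff (real R) (S \<omega>) * G \<omega>) \<partial>M) \<longlonglongrightarrow> (\<integral>\<^sup>+\<omega>. ennreal (G \<omega>) \<partial>M)"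
proof (rule nn_integral_LIMSEQ)
  note [measurable] = S G
  show "incseq (\<lambda>R \<omega>. ennreal (cutoff (real R) (S \<omega>) * G \<omega>))"
    by (auto simp: incseq_def le_fun_def cutoff_def intro!: ennreal_leI mult_right_mono G0)
  show "(\<lambda>\<omega>. ennreal (cutoff (real R) (S \<omega>) * G \<omega>)) \<in> borel_measurable M" for R
    by measurable
  show "(\<lambda>R. ennreal (cutoff (real R) (S \<omega>) * G \<omega>)) \<longlonglongrightarrow> ennreal (G \<omega>)" for \<omega>
  proof (rule tendsto_eventually)
    obtain N :: nat where "S \<omega> \<le> real N" using real_arch_simple by blast
    have "ennreal (cutoff (real R) (S \<omega>) * G \<omega>) = ennreal (G \<omega>)" if "R \<ge> N" for R
    proof -
      have "S \<omega> \<le> real R" using \<open>S \<omega> \<le> real N\<close> that by (meson of_nat_le_iff order.trans)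
      then show ?thesis by (simp add: cutoff_def)
    qed
    then show "\<forall>\<^sub>F R in sequentially. ennreal (cutoff (real R) (S \<omega>) * G \<omega>) = ennreal (G \<omega>)"
      unfolding eventually_sequentially by blast
  qed
qed

text \<open>A one-sided bound suffices, as \<open>ennreal\<close> sends negative values to
  0.\<close>

lemma nn_integral_bounded_LIMSEQ:
  fixes u :: "nat \<Rightarrow> 'a \<Rightarrow> real"
  assumes "prob_space M"
    and u: "\<And>n. u n \<in> borel_measurable M" and v: "v \<in> borel_measurable M"
    and bound: "\<And>n \<omega>. \<omega> \<in> space M \<Longrightarrow> u n \<omega> \<le> C"
    and lim: "AE \<omega> in M. (\<lambda>n. u n \<omega>) \<longlonglongrightarrow> v \<omega>"
  shows "(\<lambda>n. \<integral>\<^sup>+\<omega>. ennreal (u n \<omega>) \<partial>M) \<longlonglongrightarrow> (\<integral>\<^sup>+\<omega>. ennreal (v \<omega>) \<partial>M)"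
proof -
  interpret prob_space M by fact
  note [measurable] = u v
  show ?thesis
  proof (rule nn_integral_dominated_convergence)
    show "AE \<omega> in M. ennreal (u n \<omega>) \<le> ennreal C" for n
      using bound by (auto intro!: ennreal_leI)
    show "AE \<omega> in M. (\<lambda>n. ennreal (u n \<omega>)) \<longlonglongrightarrow> ennreal (v \<omega>)"
      using lim by eventually_elim (rule tendsto_ennrealI)
    show "(\<integral>\<^sup>+\<omega>. ennreal C \<partial>M) < \<infinity>"
      by (simp add: emeasure_space_1)
  qed measurable
qed

text \<open>The augmentation adds only sets of \<open>null_sets M\<close>, which belong to
  \<open>sets M\<close>. Hence the filtration stays inside \<open>M\<close>, and adaptedness gives
  measurability.\<close>

lemma strong_solution_measurable:
  assumes W: "brownian_motion M W" and X: "strong_solution M W l \<sigma> x X" and t: "t \<ge> 0"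
  shows "X t \<in> borel_measurable M"
proof -
  let ?G = "{W s -` B \<inter> space M | s B. 0 \<le> s \<and> s \<le> t \<and> B \<in> sets borel} \<union> null_sets M"
  have G: "?G \<subseteq> sets M"
    using brownian_motionD(2)[OF W] by (auto intro: measurable_sets)
  then have "?G \<subseteq> Pow (space M)" using sets.sets_into_space by blast
  then have "sets (brownian_filtration M W t) = sigma_sets (space M) ?G"
      "space (brownian_filtration M W t) = space M"
    unfolding brownian_filtration_def by (simp_all add: space_measure_of_conv)
  moreover have "X t \<in> borel_measurable (brownian_filtration M W t)"
    using X t by (simp add: strong_solution_def)
  ultimately show ?thesis
    using sets.sigma_sets_subset[OF G] unfolding measurable_def by auto
qed

context gradient_drift
begin

text \<open>At each cutoff level both sides are limits of the same discrete numbers. Since the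
  cutoff is removed by monotone convergence, neither an integrability condition nor a martingale
  property of the density is involved.\<close>

lemma change_of_measure:
  fixes W X :: "real \<Rightarrow> 'a \<Rightarrow> real" and W' :: "real \<Rightarrow> 'b \<Rightarrow> real"
  assumes W: "brownian_motion M W" and W': "brownian_motion M' W'"
    and X: "strong_solution M W l \<sigma> x X"
    and T: "T > 0" and \<sigma>: "\<sigma> > 0" and a: "a \<ge> 0"
  defines "Y \<equiv> \<lambda>t \<omega>. x + \<sigma> * (W' t \<omega> - W' 0 \<omega>)"
  shows "(\<integral>\<^sup>+\<omega>. ennreal (exp (a * integral {0..T} (\<lambda>s. (l (X s \<omega>))\<^sup>2 / \<sigma>\<^sup>2))) \<partial>M) =
    (\<integral>\<^sup>+\<omega>. ennreal (exp (a * integral {0..T} (\<lambda>s. (l (Y s \<omega>))\<^sup>2 / \<sigma>\<^sup>2)) *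
       (exp ((L (Y T \<omega>) - L (Y 0 \<omega>)) / \<sigma>\<^sup>2 - integral {0..T} (\<lambda>s. (l (Y s \<omega>))\<^sup>2) / (2 * \<sigma>\<^sup>2)) *
        exp (integral {0..T} (\<lambda>s. - (l' (Y s \<omega>) / 2))))) \<partial>M')"
    (is "?lhs = ?rhs")
proof -
  note W_meas [measurable] = brownian_motionD(2)[OF W] and W'_meas [measurable] = brownian_motionD(2)[OF W']
  have X_meas: "X t \<in> borel_measurable M" if "t \<ge> 0" for t
    by (rule strong_solution_measurable[OF W X that])
  have X_cont: "continuous_on {0..T} (\<lambda>t. X t \<omega>)" if "\<omega> \<in> space M" for \<omega>
    using X that by (auto simp: strong_solution_def intro: continuous_on_subset)
  have Y_meas: "Y t \<in> borel_measurable M'" if "t \<ge> 0" for t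
    unfolding Y_def using that by (intro borel_measurable_add borel_measurable_times borel_measurable_diff W'_meas) auto
  have Y_cont: "continuous_on {0..T} (\<lambda>t. Y t \<omega>)" if "\<omega> \<in> space M'" for \<omega>
    unfolding Y_def
    by (intro continuous_intros continuous_on_subset[OF brownian_motionD(4)[OF W' that]]) auto
  have sq: "continuous_on UNIV (\<lambda>u. (l u)\<^sup>2 / \<sigma>\<^sup>2)" "continuous_on UNIV (\<lambda>u. (l u)\<^sup>2)"
    "continuous_on UNIV (\<lambda>u. - (l' u / 2))"
    using \<sigma> by (auto intro!: continuous_intros l_cont l'_cont)
  define GX where "GX \<omega> = exp (a * integral {0..T} (\<lambda>s. (l (X s \<omega>))\<^sup>2 / \<sigma>\<^sup>2))" for \<omega>
  define GY where "GY \<omega> = exp (a * integral {0..T} (\<lambda>s. (l (Y s \<omega>))\<^sup>2 / \<sigma>\<^sup>2))" for \<omega>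
  define DY where "DY \<omega> = exp ((L (Y T \<omega>) - L (Y 0 \<omega>)) / \<sigma>\<^sup>2 -
      integral {0..T} (\<lambda>s. (l (Y s \<omega>))\<^sup>2) / (2 * \<sigma>\<^sup>2)) * exp (integral {0..T} (\<lambda>s. - (l' (Y s \<omega>) / 2)))" for \<omega>
  define SX where "SX \<omega> = (SUP s\<in>{0..T}. \<bar>X s \<omega>\<bar>)" for \<omega>
  define SY where "SY \<omega> = (SUP s\<in>{0..T}. \<bar>Y s \<omega>\<bar>)" for \<omega>
  have SX [measurable]: "SX \<in> borel_measurable M"
    unfolding SX_def by (rule measurable_path_sup[OF T X_meas X_cont]) auto
  have SY [measurable]: "SY \<in> borel_measurable M'"
    unfolding SY_def by (rule measurable_path_sup[OF T Y_meas Y_cont]) auto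
  have GX [measurable]: "GX \<in> borel_measurable M"
  proof -
    have [measurable]: "(\<lambda>\<omega>. integral {0..T} (\<lambda>s. (l (X s \<omega>))\<^sup>2 / \<sigma>\<^sup>2)) \<in> borel_measurable M"
      by (rule measurable_path_integral[OF T X_meas X_cont sq(1)]) auto
    show ?thesis unfolding GX_def by measurable
  qed
  have GY [measurable]: "GY \<in> borel_measurable M'"
  proof -
    have [measurable]: "(\<lambda>\<omega>. integral {0..T} (\<lambda>s. (l (Y s \<omega>))\<^sup>2 / \<sigma>\<^sup>2)) \<in> borel_measurable M'"
      by (rule measurable_path_integral[OF T Y_meas Y_cont sq(1)]) auto
    show ?thesis unfolding GY_def by measurable
  qed
  have DY [measurable]: "DY \<in> borel_measurable M'"
  proof -
    have [measurable]: "(\<lambda>\<omega>. integral {0..T} (\<lambda>s. (l (Y s \<omega>))\<^sup>2)) \<in> borel_measurable M'"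
      by (rule measurable_path_integral[OF T Y_meas Y_cont sq(2)]) auto
    have [measurable]: "(\<lambda>\<omega>. integral {0..T} (\<lambda>s. - (l' (Y s \<omega>) / 2))) \<in> borel_measurable M'"
      by (rule measurable_path_integral[OF T Y_meas Y_cont sq(3)]) auto
    have [measurable]: "Y T \<in> borel_measurable M'" "Y 0 \<in> borel_measurable M'"
      using T by (auto intro: Y_meas)
    show ?thesis unfolding DY_def by measurable
  qed
  define ZX where "ZX n \<omega> = iterate_noise (implicit_step (T / real n)) x
      (\<lambda>k. \<sigma> * W (T * real (Suc k) / real n) \<omega> - \<sigma> * W (T * real k / real n) \<omega>)" for n \<omega>
  define ZY where "ZY n \<omega> = (\<lambda>k. Y (T * real k / real n) \<omega>)" for n \<omega>
  have ZX_limit: "AE \<omega> in M. grid_limit T (\<lambda>t. X t \<omega>) (\<lambda>n. ZX n \<omega>)"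
  proof -
    have "AE \<omega> in M. X 0 \<omega> = x \<and>
        (\<forall>t\<ge>0. X t \<omega> = x + integral {0..t} (\<lambda>s. l (X s \<omega>)) + \<sigma> * W t \<omega>)"
      using X by (simp add: strong_solution_def)
    then show ?thesis
    proof (rule AE_mp, intro AE_I2 impI)
      fix \<omega> assume "\<omega> \<in> space M" and sol: "X 0 \<omega> = x \<and>
        (\<forall>t\<ge>0. X t \<omega> = x + integral {0..t} (\<lambda>s. l (X s \<omega>)) + \<sigma> * W t \<omega>)"
      show "grid_limit T (\<lambda>t. X t \<omega>) (\<lambda>n. ZX n \<omega>)"
        unfolding ZX_def
        using implicit_scheme_converges[OF T X_cont[OF \<open>\<omega> \<in> space M\<close>], of x "\<lambda>t. \<sigma> * W t \<omega>"] sol by simp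
    qed
  qed
  have ZY_limit: "grid_limit T (\<lambda>t. Y t \<omega>) (\<lambda>n. ZY n \<omega>)" for \<omega>
    unfolding ZY_def by (rule grid_limit_self)
  have ZX_meas: "(\<lambda>\<omega>. restrict (ZX n \<omega>) {..n}) \<in> measurable M (PiM {..n} (\<lambda>_. borel))" if "n > 0" for n
  proof (rule measurable_restrict)
    fix k assume "k \<in> {..n}"
    have noise: "(\<lambda>\<omega>. \<lambda>k\<in>{..<n}. \<sigma> * W (T * real (Suc k) / real n) \<omega> - \<sigma> * W (T * real k / real n) \<omega>)
        \<in> measurable M (PiM {..<n} (\<lambda>_. borel))"
      using T by (intro measurable_restrict borel_measurable_diff borel_measurable_times W_meas) auto
    have "(\<lambda>v. iterate_noise (implicit_step (T / real n)) x v k) \<in> borel_measurable (PiM {..<n} (\<lambda>_. borel))"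
      using T \<open>k \<in> {..n}\<close> by (intro measurable_iterate_noise measurable_implicit_step) auto
    from measurable_compose[OF noise this] show "(\<lambda>\<omega>. ZX n \<omega> k) \<in> borel_measurable M"
      \<comment> \<open>The chain up to index \<open>k\<close> reads only noise coordinates below
        \<open>n\<close>, so restricting the noise changes nothing.\<close>
      unfolding ZX_def
      by (rule measurable_cong[THEN iffD1, rotated]) (rule iterate_noise_cong, use \<open>k \<in> {..n}\<close> in auto)
  qed
  have ZY_meas: "(\<lambda>\<omega>. restrict (ZY n \<omega>) {..n}) \<in> measurable M' (PiM {..n} (\<lambda>_. borel))" for n
    unfolding ZY_def using T by (intro measurable_restrict Y_meas) auto
  have dens_local: "grid_density \<sigma> T n (restrict z {..n}) = grid_density \<sigma> T n z" for n z
    by (simp add: grid_density_def)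
  have dens_meas: "grid_density \<sigma> T n \<in> borel_measurable (PiM {..n} (\<lambda>_. borel))" for n
    unfolding grid_density_def
    by (intro borel_measurable_prod measurable_grid_comp measurable_step_density) auto
  have truncated: "(\<integral>\<^sup>+\<omega>. ennreal (cutoff R (SX \<omega>) * GX \<omega>) \<partial>M) =
      (\<integral>\<^sup>+\<omega>. ennreal (cutoff R (SY \<omega>) * (GY \<omega> * DY \<omega>)) \<partial>M')" for R
  proof -
    let ?f = "grid_functional \<sigma> a T R"
    obtain C where C: "\<And>n z. n > 0 \<Longrightarrow> ?f n z \<le> C"
      using grid_functional_bounded[OF T a] by blast
    obtain C' where C': "\<And>n z. n > 0 \<Longrightarrow> z 0 = x \<Longrightarrow> ?f n z * grid_density \<sigma> T n z \<le> C'"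
      using weighted_grid_functional_bounded[OF T a] by blast
    \<comment> \<open>The shift to \<open>Suc n\<close> avoids the degenerate mesh at
      \<open>n = 0\<close>, so that the bounds hold for every member of the sequence.\<close>
    have "(\<lambda>n. \<integral>\<^sup>+\<omega>. ennreal (?f (Suc n) (ZX (Suc n) \<omega>)) \<partial>M) \<longlonglongrightarrow>
        (\<integral>\<^sup>+\<omega>. ennreal (cutoff R (SX \<omega>) * GX \<omega>) \<partial>M)"
    proof (rule nn_integral_bounded_LIMSEQ[OF brownian_motionD(1)[OF W]])
      show "(\<lambda>\<omega>. ?f (Suc n) (ZX (Suc n) \<omega>)) \<in> borel_measurable M" for n
        using measurable_compose[OF ZX_meas measurable_grid_functional, of "Suc n"]
        by (simp add: grid_functional_local)
      show "?f (Suc n) (ZX (Suc n) \<omega>) \<le> C" for n \<omega> by (rule C) simp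
      show "AE \<omega> in M. (\<lambda>n. ?f (Suc n) (ZX (Suc n) \<omega>)) \<longlonglongrightarrow> cutoff R (SX \<omega>) * GX \<omega>"
        using ZX_limit
      proof (rule AE_mp, intro AE_I2 impI)
        fix \<omega> assume "\<omega> \<in> space M" "grid_limit T (\<lambda>t. X t \<omega>) (\<lambda>n. ZX n \<omega>)"
        then show "(\<lambda>n. ?f (Suc n) (ZX (Suc n) \<omega>)) \<longlonglongrightarrow> cutoff R (SX \<omega>) * GX \<omega>"
          unfolding SX_def GX_def by (intro LIMSEQ_Suc[OF grid_functional_limit[OF T]] X_cont)
      qed
    qed measurable
    moreover have "(\<lambda>n. \<integral>\<^sup>+\<omega>. ennreal (?f (Suc n) (ZY (Suc n) \<omega>) * grid_density \<sigma> T (Suc n) (ZY (Suc n) \<omega>)) \<partial>M')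
        \<longlonglongrightarrow> (\<integral>\<^sup>+\<omega>. ennreal (cutoff R (SY \<omega>) * GY \<omega> * DY \<omega>) \<partial>M')"
    proof (rule nn_integral_bounded_LIMSEQ[OF brownian_motionD(1)[OF W']])
      show "(\<lambda>\<omega>. ?f (Suc n) (ZY (Suc n) \<omega>) * grid_density \<sigma> T (Suc n) (ZY (Suc n) \<omega>)) \<in> borel_measurable M'" for n
        using borel_measurable_times[OF measurable_compose[OF ZY_meas[of "Suc n"] measurable_grid_functional]
            measurable_compose[OF ZY_meas[of "Suc n"] dens_meas]]
        by (simp add: grid_functional_local dens_local)
      \<comment> \<open>Subtracting \<open>W' 0\<close> in \<open>Y\<close> makes the chain start at
        \<open>x\<close> for every \<open>\<omega>\<close>, as the bound demands.\<close>
      show "?f (Suc n) (ZY (Suc n) \<omega>) * grid_density \<sigma> T (Suc n) (ZY (Suc n) \<omega>) \<le> C'" for n \<omega>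
        by (rule C') (simp_all add: ZY_def Y_def)
      show "AE \<omega> in M'. (\<lambda>n. ?f (Suc n) (ZY (Suc n) \<omega>) * grid_density \<sigma> T (Suc n) (ZY (Suc n) \<omega>))
          \<longlonglongrightarrow> cutoff R (SY \<omega>) * GY \<omega> * DY \<omega>"
      proof (rule AE_I2)
        fix \<omega> assume \<omega>: "\<omega> \<in> space M'"
        show "(\<lambda>n. ?f (Suc n) (ZY (Suc n) \<omega>) * grid_density \<sigma> T (Suc n) (ZY (Suc n) \<omega>))
          \<longlonglongrightarrow> cutoff R (SY \<omega>) * GY \<omega> * DY \<omega>"
          unfolding SY_def GY_def DY_def
          by (intro tendsto_mult LIMSEQ_Suc[OF grid_functional_limit[OF T Y_cont[OF \<omega>] ZY_limit]]
              LIMSEQ_Suc[OF grid_density_limit[OF T Y_cont[OF \<omega>] ZY_limit]])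
      qed
    qed measurable
    moreover have "(\<integral>\<^sup>+\<omega>. ennreal (?f (Suc n) (ZX (Suc n) \<omega>)) \<partial>M) =
        (\<integral>\<^sup>+\<omega>. ennreal (?f (Suc n) (ZY (Suc n) \<omega>) * grid_density \<sigma> T (Suc n) (ZY (Suc n) \<omega>)) \<partial>M')" for n
      unfolding ZX_def ZY_def Y_def
      by (rule discrete_change_of_measure[OF W W' T \<sigma> zero_less_Suc measurable_grid_functional
            grid_functional_nonneg grid_functional_local])
    ultimately show ?thesis by (simp add: mult.assoc LIMSEQ_unique)
  qed
  have "(\<lambda>R. \<integral>\<^sup>+\<omega>. ennreal (cutoff (real R) (SX \<omega>) * GX \<omega>) \<partial>M) \<longlonglongrightarrow> (\<integral>\<^sup>+\<omega>. ennreal (GX \<omega>) \<partial>M)"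
  proof (rule nn_integral_cutoff_limit)
    show "0 \<le> GX \<omega>" for \<omega> by (simp add: GX_def)
  qed measurable
  moreover have "(\<lambda>R. \<integral>\<^sup>+\<omega>. ennreal (cutoff (real R) (SY \<omega>) * (GY \<omega> * DY \<omega>)) \<partial>M') \<longlonglongrightarrow>
      (\<integral>\<^sup>+\<omega>. ennreal (GY \<omega> * DY \<omega>) \<partial>M')"
  proof (rule nn_integral_cutoff_limit)
    show "0 \<le> GY \<omega> * DY \<omega>" for \<omega> by (simp add: GY_def DY_def)
  qed measurable
  ultimately have "(\<integral>\<^sup>+\<omega>. ennreal (GX \<omega>) \<partial>M) = (\<integral>\<^sup>+\<omega>. ennreal (GY \<omega> * DY \<omega>) \<partial>M')"
    unfolding truncated by (rule LIMSEQ_unique)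
  then show ?thesis by (simp only: GX_def GY_def DY_def)
qed

end

section \<open>The law on path space and the final identity\<close>

lemma continuous_Q0_path:
  assumes "brownian_motion M W" "\<omega> \<in> space M"
  shows "continuous_on {0..T} (\<lambda>t\<in>{0..T}. x + \<sigma> * W t \<omega>)"
proof -
  have "continuous_on {0..T} (\<lambda>t. x + \<sigma> * W t \<omega>)"
    by (intro continuous_intros continuous_on_subset[OF brownian_motionD(4)[OF assms]]) auto
  then show ?thesis by (rule continuous_on_eq) simp
qed

lemma measurable_Q0_path:
  assumes W: "brownian_motion M W"
  shows "(\<lambda>\<omega>. \<lambda>t\<in>{0..T}. x + \<sigma> * W t \<omega>) \<in> measurable M (path_space T)"
  unfolding path_space_def
proof (rule measurable_restrict_space2)
  show "(\<lambda>\<omega>. \<lambda>t\<in>{0..T}. x + \<sigma> * W t \<omega>) \<in> measurable M (PiM {0..T} (\<lambda>_. borel))"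
    by (intro measurable_restrict borel_measurable_add borel_measurable_times brownian_motionD(2)[OF W]) auto
qed (use continuous_Q0_path[OF W] in auto)

lemma measurable_path_space_eval:
  "t \<in> {0..T} \<Longrightarrow> (\<lambda>w. w t) \<in> borel_measurable (path_space T)"
  unfolding path_space_def by (intro measurable_restrict_space1 measurable_component_singleton)

lemma continuous_path_space:
  "w \<in> space (path_space T) \<Longrightarrow> continuous_on {0..T} (\<lambda>t. w t)"
  by (simp add: path_space_def space_restrict_space)

theorem corollary3p3:
  fixes l L :: "real \<Rightarrow> real" and \<sigma> a x T :: real
    and M :: "'a measure" and W X :: "real \<Rightarrow> 'a \<Rightarrow> real"
    and M' :: "'b measure" and W' :: "real \<Rightarrow> 'b \<Rightarrow> real"
  assumes "\<sigma> > 0"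
    and "l \<in> class_D"
    and "\<And>y. (L has_real_derivative l y) (at y)"
    and "a \<ge> 0" and "T > 0"
    and "brownian_motion M W" and "strong_solution M W l \<sigma> x X"
    and "brownian_motion M' W'"
  shows "N_functional M X l \<sigma> a T =
           ennreal (exp (- L x / \<sigma>\<^sup>2)) *
           (\<integral>\<^sup>+ w. ennreal (exp (L (w T) / \<sigma>\<^sup>2 + integral {0..T} (\<lambda>s. Psi l \<sigma> a (w s))))
              \<partial>(Q0 M' W' \<sigma> x T))"
proof -
  note \<sigma> = assms(1) and T = assms(5) and W' = assms(8)
  obtain l' where l_vec: "\<And>y. (l has_vector_derivative l' y) (at y)" and l'_cont: "continuous_on UNIV l'"
    using assms(2) by (auto simp: class_D_def C1_differentiable_on_def)
  have l_deriv: "(l has_real_derivative l' y) (at y)" for y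
    using l_vec by (simp add: has_real_derivative_iff_has_vector_derivative)
  have "antimono l"
    using assms(2) by (auto simp: class_D_def monotone_on_def less_le intro!: antimonoI)
  have l'_nonpos: "l' y \<le> 0" for y
  proof -
    have "- l' y \<ge> 0"
    proof (rule mono_on_imp_deriv_nonneg[of UNIV "\<lambda>u. - l u"])
      show "mono_on UNIV (\<lambda>u. - l u)"
        using \<open>antimono l\<close> by (auto simp: mono_on_def dest: antimonoD)
      show "((\<lambda>u. - l u) has_real_derivative - l' y) (at y)"
        by (rule DERIV_minus[OF l_deriv])
    qed simp
    then show ?thesis by simp
  qed
  interpret gradient_drift L l l'
    by unfold_locales (use assms(3) l_deriv l'_cont l'_nonpos in auto)
  have Psi_eq: "Psi l \<sigma> a y = - (l' y / 2) + (a - 1/2) * ((l y)\<^sup>2 / \<sigma>\<^sup>2)" for y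
    using DERIV_imp_deriv[OF l_deriv] by (simp add: Psi_def)
  have Psi_cont: "continuous_on UNIV (Psi l \<sigma> a)"
    unfolding Psi_eq[abs_def] using \<sigma> by (intro continuous_intros l_cont l'_cont) auto
  let ?Y = "\<lambda>t \<omega>. x + \<sigma> * (W' t \<omega> - W' 0 \<omega>)"
  let ?F = "\<lambda>w. ennreal (exp (L (w T) / \<sigma>\<^sup>2 + integral {0..T} (\<lambda>s. Psi l \<sigma> a (w s))))"
  have F: "?F \<in> borel_measurable (path_space T)"
  proof -
    have [measurable]: "(\<lambda>w. integral {0..T} (\<lambda>s. Psi l \<sigma> a (w s))) \<in> borel_measurable (path_space T)"
      by (rule measurable_path_integral[OF T measurable_path_space_eval continuous_path_space Psi_cont])
    have [measurable]: "(\<lambda>w. w T) \<in> borel_measurable (path_space T)"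
      using T by (intro measurable_path_space_eval) simp
    show ?thesis by measurable
  qed
  have "N_functional M X l \<sigma> a T =
    (\<integral>\<^sup>+\<omega>. ennreal (exp (a * integral {0..T} (\<lambda>s. (l (?Y s \<omega>))\<^sup>2 / \<sigma>\<^sup>2)) *
       (exp ((L (?Y T \<omega>) - L (?Y 0 \<omega>)) / \<sigma>\<^sup>2 - integral {0..T} (\<lambda>s. (l (?Y s \<omega>))\<^sup>2) / (2 * \<sigma>\<^sup>2)) *
        exp (integral {0..T} (\<lambda>s. - (l' (?Y s \<omega>) / 2))))) \<partial>M')"
    unfolding N_functional_def by (rule change_of_measure[OF assms(6) W' assms(7) T \<sigma> assms(4)])
  also have "\<dots> = (\<integral>\<^sup>+\<omega>. ennreal (exp (- L x / \<sigma>\<^sup>2)) * ?F (\<lambda>t\<in>{0..T}. x + \<sigma> * W' t \<omega>) \<partial>M')"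
  proof (rule nn_integral_cong_AE)
    have "AE \<omega> in M'. \<omega> \<in> space M'" by simp
    \<comment> \<open>Only now is \<open>W' 0 = 0\<close> used: almost surely \<open>?Y\<close> is
      the path \<open>x + \<sigma> * W'\<close>, whose restriction to \<open>{0..T}\<close> has the
      law \<open>Q0\<close>.\<close>
    with brownian_motionD(3)[OF W'] show "AE \<omega> in M'.
      ennreal (exp (a * integral {0..T} (\<lambda>s. (l (?Y s \<omega>))\<^sup>2 / \<sigma>\<^sup>2)) *
       (exp ((L (?Y T \<omega>) - L (?Y 0 \<omega>)) / \<sigma>\<^sup>2 - integral {0..T} (\<lambda>s. (l (?Y s \<omega>))\<^sup>2) / (2 * \<sigma>\<^sup>2)) *
        exp (integral {0..T} (\<lambda>s. - (l' (?Y s \<omega>) / 2))))) =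
      ennreal (exp (- L x / \<sigma>\<^sup>2)) * ?F (\<lambda>t\<in>{0..T}. x + \<sigma> * W' t \<omega>)"
    proof eventually_elim
      case (elim \<omega>)
      let ?y = "\<lambda>t. x + \<sigma> * W' t \<omega>"
      have y: "continuous_on {0..T} ?y"
        by (intro continuous_intros continuous_on_subset[OF brownian_motionD(4)[OF W' elim(2)]]) auto
      have int: "(\<lambda>s. - (l' (?y s) / 2)) integrable_on {0..T}" "(\<lambda>s. (l (?y s))\<^sup>2 / \<sigma>\<^sup>2) integrable_on {0..T}"
        using \<sigma> by (intro integrable_continuous_interval continuous_intros
          continuous_on_compose2[OF l_cont y] continuous_on_compose2[OF l'_cont y]; simp)+
      have "integral {0..T} (\<lambda>s. Psi l \<sigma> a ((\<lambda>t\<in>{0..T}. ?y t) s)) = integral {0..T} (\<lambda>s. Psi l \<sigma> a (?y s))"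
        by (rule integral_cong) simp
      also have "\<dots> = integral {0..T} (\<lambda>s. - (l' (?y s) / 2)) +
          (a - 1/2) * integral {0..T} (\<lambda>s. (l (?y s))\<^sup>2 / \<sigma>\<^sup>2)"
        unfolding Psi_eq using integral_add[OF int(1) integrable_on_mult_right[OF int(2)]]
        by (simp only: integral_mult_right)
      finally have I: "integral {0..T} (\<lambda>s. Psi l \<sigma> a ((\<lambda>t\<in>{0..T}. ?y t) s)) =
          integral {0..T} (\<lambda>s. - (l' (?y s) / 2)) + (a - 1/2) * integral {0..T} (\<lambda>s. (l (?y s))\<^sup>2 / \<sigma>\<^sup>2)" .
      have J: "integral {0..T} (\<lambda>s. (l (?y s))\<^sup>2) / (2 * \<sigma>\<^sup>2) = integral {0..T} (\<lambda>s. (l (?y s))\<^sup>2 / \<sigma>\<^sup>2) / 2"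
        by (simp add: mult.commute[of 2])
      \<comment> \<open>\<open>A\<close> stands for the integral of
        \<open>(l (?y s))\<^sup>2 / \<sigma>\<^sup>2\<close>. The functional contributes
        \<open>a * A\<close> and the density \<open>- A / 2\<close>, which together give the
        coefficient \<open>a - 1/2\<close> in \<open>Psi\<close>; \<open>i\<close> is the Jacobian
        part.\<close>
      have exponents: "exp (a * A) * (exp ((p - q) / r - A / 2) * exp i) =
          exp (- q / r) * exp (p / r + (i + (a - 1/2) * A))" for A p q r i :: real
        by (simp add: algebra_simps diff_divide_distrib flip: exp_add)
      have end_pt: "(\<lambda>t\<in>{0..T}. ?y t) T = ?y T" using T by simp
      show ?case
        unfolding I end_pt elim(1) diff_zero J mult_zero_right add_0_right exponents
        by (rule ennreal_mult) simp_all
    qed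
  qed
  also have "\<dots> = ennreal (exp (- L x / \<sigma>\<^sup>2)) * (\<integral>\<^sup>+\<omega>. ?F (\<lambda>t\<in>{0..T}. x + \<sigma> * W' t \<omega>) \<partial>M')"
    by (rule nn_integral_cmult[OF measurable_compose[OF measurable_Q0_path[OF W'] F]])
  also have "\<dots> = ennreal (exp (- L x / \<sigma>\<^sup>2)) * (\<integral>\<^sup>+w. ?F w \<partial>Q0 M' W' \<sigma> x T)"
    unfolding Q0_def using F by (subst nn_integral_distr[OF measurable_Q0_path[OF W']]) simp_all
  finally show ?thesis .
qed

end
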